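(* For every real $\beta>1$, the transformation $T_{-\beta}$ is locally eventually onto on $(0,1]\setminus G(\beta)$, $$T_{-\beta}^{-1}(G(\beta))\subset G(\beta)\quad\text{and}\quad \lim_{k\to\infty}\lambda\big(T_{-\beta}^{-k}(G(\beta))\big)=0,$$ where $\lambda$ denotes Lebesgue measure.
   Context: For real $\beta>1$, $T_{-\beta}:(0,1]\to(0,1]$, $x\mapsto -\beta x+\lfloor \beta x\rfloor+1$. A dynamical system $(X,T)$ is locally eventually onto (topologically exact) if for every non-empty open subset $U\subset X$ there is a positive integer $n$ with $T^n(U)=X$. Here $X=(0,1]\setminus G(\beta)$ carries the subspace topology and $T$ is the restriction of $T_{-\beta}$ to $X$. Inclusion $\subset$ is not necessarily strict. For $n\ge 0$ let $g_n=\lfloor 2^{n+1}/3\rfloor$. For $n\ge1$, $\gamma_n$ is the unique positive real number with $\gamma_n^{g_n+1}=\gamma_n+1$, and $\gamma_0=\infty$; one has $2>\gamma_1>\gamma_2>\cdots>1$ and $\gamma_n\to 1$. For $n\ge 0$ and $1<\beta<\gamma_n$, $$\mathcal{G}_n(\beta)=\Big\{G_{m,k}(\beta)\ \Big|\ 0\le m<n,\ 0\le k<\tfrac{2^{m+1}+(-1)^m}{3}\Big\},$$ where $m,k$ are integers and $G_{m,k}(\beta)$ is the open interval $$G_{m,k}(\beta)=\begin{cases}\big(T_{-\beta}^{2^{m+1}+k}(1),\,T_{-\beta}^{(2^{m+2}-(-1)^m)/3+k}(1)\big)&\text{if } k \text{ is even},\\ \big(T_{-\beta}^{(2^{m+2}-(-1)^m)/3+k}(1),\,T_{-\beta}^{2^{m+1}+k}(1)\big)&\text{if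 } k\text{ is odd}.\end{cases}$$ Finally $G(\beta)=\bigcup_{I\in\mathcal{G}_n(\beta)}I$, where $n\ge0$ is the unique integer with $\gamma_{n+1}\le\beta<\gamma_n$ (so $G(\beta)=\emptyset$ for $\beta\ge\gamma_1$). *)

theory Defs
  imports "HOL-Analysis.Analysis"
begin

text \<open>
  The formula of \<open>T\<^bsub>-\<beta>\<^esub>\<close> is used on all of the reals; it is only of interest on the interval
  \<open>{0<..1}\<close>, which it maps to itself.
\<close>

definition neg_beta_map :: "real \<Rightarrow> real \<Rightarrow> real" where
  "neg_beta_map \<beta> x = - \<beta> * x + of_int \<lfloor>\<beta> * x\<rfloor> + 1"

lemma neg_beta_map_range: "neg_beta_map \<beta> x \<in> {0<..1}"
  unfolding neg_beta_map_def greaterThanAtMost_iff minus_mult_left[symmetric]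
  using floor_correct[of "\<beta> * x"] by linarith

text \<open>
  Topological exactness of \<open>(X, T)\<close>, where \<open>X\<close> carries the subspace topology and \<open>T\<close> restricts to
  a self-map of \<open>X\<close>.
\<close>

definition locally_eventually_onto ::
    "'a::topological_space set \<Rightarrow> ('a \<Rightarrow> 'a) \<Rightarrow> bool" where
  "locally_eventually_onto X T \<longleftrightarrow>
     T \<in> X \<rightarrow> X \<and>
     (\<forall>U. openin (top_of_set X) U \<and> U \<noteq> {} \<longrightarrow> (\<exists>n::nat. n > 0 \<and> (T ^^ n) ` U = X))"

definition g_exp :: "nat \<Rightarrow> nat" where
  "g_exp n = nat \<lfloor>2 ^ (n + 1) / (3::real)\<rfloor>"

definition gamma_seq :: "nat \<Rightarrow> ereal" where
  "gamma_seq n =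
     (if n = 0 then \<infinity> else ereal (THE x::real. x > 0 \<and> x ^ (g_exp n + 1) = x + 1))"

text \<open>
  The exponent \<open>(2 ^ (m + 2) - (-1) ^ m) / 3\<close>; the division is exact and the result is nonnegative.
\<close>

definition gap_exp :: "nat \<Rightarrow> nat" where
  "gap_exp m = nat ((2 ^ (m + 2) - (- 1) ^ m) div (3::int))"

lemma of_nat_gap_exp: "real (gap_exp m) = (2 ^ (m + 2) - (- 1) ^ m) / 3"
proof -
  have "\<exists>q::int. 2 ^ (m + 2) - (- 1) ^ m = 3 * q \<and> q \<ge> 0"
  proof (induction m)
    case 0
    show ?case by (intro exI[of _ 1]) simp
  next
    case (Suc m)
    then obtain q :: int where q: "2 ^ (m + 2) - (- 1) ^ m = 3 * q" "q \<ge> 0" by blast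
    have "(- 1 :: int) ^ m = 1 \<or> (- 1 :: int) ^ m = - 1"
      by (cases "even m") auto
    with q show ?case
      by (intro exI[of _ "2 * q + (- 1) ^ m"]) (auto simp: algebra_simps, presburger)
  qed
  then obtain q :: int where q: "2 ^ (m + 2) - (- 1) ^ m = 3 * q" "q \<ge> 0" by blast
  have "gap_exp m = nat q" using q by (simp add: gap_exp_def)
  moreover have "real_of_int (2 ^ (m + 2) - (- 1) ^ m) = real_of_int (3 * q)"
    using q(1) by (simp only:)
  ultimately show ?thesis using q(2) by simp
qed

definition gap_interval :: "real \<Rightarrow> nat \<Rightarrow> nat \<Rightarrow> real set" where
  "gap_interval \<beta> m k =
     (let a = (neg_beta_map \<beta> ^^ (2 ^ (m + 1) + k)) 1;
          b = (neg_beta_map \<beta> ^^ (gap_exp m + k)) 1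
      in if even k then {a<..<b} else {b<..<a})"

definition gap_family :: "nat \<Rightarrow> real \<Rightarrow> real set set" where
  "gap_family n \<beta> =
     {gap_interval \<beta> m k | m k. m < n \<and> real k < (2 ^ (m + 1) + (- 1) ^ m) / 3}"

definition gap_set :: "real \<Rightarrow> real set" where
  "gap_set \<beta> =
     \<Union> (gap_family (THE n. gamma_seq (n + 1) \<le> ereal \<beta> \<and> ereal \<beta> < gamma_seq n) \<beta>)"

end

theory Submission
  imports Defs
begin

text \<open>
  The map \<open>F y = min (1 + y) (1 - \<beta> * y)\<close> is a continuous skew tent map of \<open>{1 - \<beta>..1}\<close>, and
  \<open>T\<^bsub>-\<beta>\<^esub>\<close> is its first return map to \<open>{0<..1}\<close>: the time of \<open>T\<^bsub>-\<beta>\<^esub>\<close> counts the positive points of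
  an \<open>F\<close>-orbit. For \<open>\<beta> < \<gamma>\<^sub>n\<close> the map \<open>F\<close> is \<open>n\<close> times renormalizable by period doubling, and
  \<open>F ^^ 2 ^ n\<close>, restricted to an interval around the turning point \<open>0\<close>, is a skew tent map with
  slopes \<open>a = \<beta> ^ l\<close> and \<open>- b = - \<beta> ^ r\<close>, where \<open>l\<close> and \<open>r\<close>, the \<open>T\<^bsub>-\<beta>\<^esub>\<close>-times of its two branches,
  differ by one. It is renormalizable again iff \<open>a * b\<^sup>2 < a + b\<close>, i.e. iff \<open>\<beta> < \<gamma>\<^bsub>n+1\<^esub>\<close>.
  The gaps are what the successive renormalization intervals leave out. Each contains a single
  repelling periodic orbit, so only countably many points stay in the gaps forever. When
  \<open>a * b\<^sup>2 \<ge> a + b\<close>, intervals grow until they cover one side of the fixed point of the tent map;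
  the two sides are then exchanged in times \<open>r\<close>, and the second covers the first also in time \<open>l\<close>.
  Since \<open>2 * r\<close> and \<open>r + l\<close> are consecutive, everything is covered at all large times.
\<close>

subsection \<open>The numbers \<open>g\<^sub>n\<close> and \<open>\<gamma>\<^sub>n\<close>\<close>

lemma g_exp_eq_div: "g_exp n = 2 ^ (n + 1) div 3"
proof -
  have "\<lfloor>real (2 ^ (n + 1)) / real 3\<rfloor> = int (2 ^ (n + 1) div 3)"
    by (rule floor_divide_of_nat_eq)
  then show ?thesis by (simp add: g_exp_def)
qed

lemma two_power_eq_g_exp: "2 ^ (n + 1) = 3 * g_exp n + 1 + of_bool (even n)"
proof -
  have "(2::nat) ^ (n + 1) mod 3 = 1 + of_bool (even n)"
  proof (induction n)
    case (Suc n)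
    have "(2::nat) ^ (Suc n + 1) mod 3 = (2 * (2 ^ (n + 1) mod 3)) mod 3"
      by (simp add: mod_mult_right_eq)
    then show ?case using Suc by (cases "even n") auto
  qed auto
  moreover have "2 ^ (n + 1) = 3 * ((2::nat) ^ (n + 1) div 3) + 2 ^ (n + 1) mod 3"
    by (metis mult_div_mod_eq)
  ultimately show ?thesis unfolding g_exp_eq_div by linarith
qed

lemma g_exp_0: "g_exp 0 = 0"
  by (simp add: g_exp_eq_div)

lemma g_exp_Suc: "g_exp (Suc n) = 2 * g_exp n + of_bool (even n)"
  using two_power_eq_g_exp[of n] two_power_eq_g_exp[of "Suc n"] by (cases "even n") auto

lemma g_exp_mono: "m \<le> n \<Longrightarrow> g_exp m \<le> g_exp n"
  by (rule lift_Suc_mono_le) (auto simp: g_exp_Suc)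

lemma g_exp_ge: "n \<le> g_exp n"
proof (induction n)
  case (Suc n)
  then show ?case by (cases "n = 0") (auto simp: g_exp_Suc g_exp_0)
qed auto

lemma gap_exp_eq: "gap_exp m = g_exp (Suc m) + of_bool (odd m)"
proof -
  have "real (2 ^ (Suc m + 1)) = real (3 * g_exp (Suc m) + 1 + of_bool (even (Suc m)))"
    by (simp only: two_power_eq_g_exp)
  then have "real (gap_exp m) = real (g_exp (Suc m) + of_bool (odd m))"
    unfolding of_nat_gap_exp by (cases "even m") (auto simp: field_simps)
  then show ?thesis by (simp only: of_nat_eq_iff)
qed

lemma g_exp_add_Suc: "g_exp (Suc m) + g_exp m + 1 = 2 ^ (m + 1)"
  using two_power_eq_g_exp[of m] by (simp add: g_exp_Suc)

lemma of_nat_gap_count: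
  "real (g_exp m + of_bool (even m)) = (2 ^ (m + 1) + (- 1) ^ m) / 3"
proof -
  have "real (2 ^ (m + 1)) = real (3 * g_exp m + 1 + of_bool (even m))"
    by (simp only: two_power_eq_g_exp)
  then show ?thesis by (cases "even m") (auto simp: field_simps)
qed

text \<open>After division by the variable, \<open>x ^ k\<close> is nondecreasing and
  \<open>1 + 1 / x\<close> strictly decreasing. This yields uniqueness of the root defining
  \<open>gamma_seq\<close> and the comparison with it.\<close>

lemma power_less_add_one_trans:
  fixes x y :: real
  assumes "0 < x" "x < y" "y ^ (k + 1) \<le> y + 1"
  shows "x ^ (k + 1) < x + 1"
proof -
  have "x * (y * x ^ k) \<le> x * (y * y ^ k)"
    using assms by (intro mult_left_mono power_mono) auto
  also have "\<dots> \<le> x * (y + 1)"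
    using assms by (intro mult_left_mono) auto
  also have "\<dots> < y * (x + 1)"
    using assms by (simp add: algebra_simps)
  finally have "y * x ^ (k + 1) < y * (x + 1)" by (simp add: algebra_simps)
  then show ?thesis using assms by simp
qed

lemma less_gamma_seq_iff:
  fixes x :: real
  assumes "0 < x" "n > 0"
  shows "ereal x < gamma_seq n \<longleftrightarrow> x ^ (g_exp n + 1) < x + 1"
proof -
  let ?k = "g_exp n"
  have k: "?k \<ge> 1" using g_exp_ge[of n] assms by linarith
  have uniq: "u = v" if "u > 0" "v > 0" "u ^ (?k + 1) = u + 1" "v ^ (?k + 1) = v + 1" for u v :: real
    using power_less_add_one_trans[of u v ?k] power_less_add_one_trans[of v u ?k] that
    by (cases u v rule: linorder_cases) auto
  \<comment> \<open>With exponent at least 2, \<open>z ^ (g_exp n + 1) - z\<close> runs from 0 at 1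
    to at least 2 at 2, so it takes the value 1.\<close>
  have "(2::real) ^ 2 \<le> 2 ^ (?k + 1)" using k by (intro power_increasing) auto
  then have "\<exists>z::real. 1 \<le> z \<and> z \<le> 2 \<and> z ^ (?k + 1) - z = 1"
    by (intro IVT') (auto intro!: continuous_intros)
  then obtain z :: real where z: "z > 0" "z ^ (?k + 1) = z + 1"
    by (smt (verit, best))
  have "gamma_seq n = ereal z"
    unfolding gamma_seq_def using assms z uniq by (auto intro: the_equality)
  moreover have "x < z \<longleftrightarrow> x ^ (?k + 1) < x + 1"
    using power_less_add_one_trans[of x z ?k] power_less_add_one_trans[of z x ?k] z assms
    by (cases x z rule: linorder_cases) auto
  ultimately show ?thesis by simp
qed

text \<open>The least \<open>n\<close> whose next power reaches \<open>x + 1\<close> is the index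
  chosen in \<open>gap_set\<close>: as \<open>g_exp\<close> is monotone, \<open>x\<close> lies below
  \<open>gamma_seq m\<close> exactly for \<open>m \<le> n\<close>.\<close>

lemma gap_level:
  fixes x :: real
  assumes "1 < x"
  shows "\<exists>n. gap_set x = \<Union> (gap_family n x) \<and>
    (\<forall>m<n. x ^ (g_exp (Suc m) + 1) < x + 1) \<and> x + 1 \<le> x ^ (g_exp (Suc n) + 1)"
proof -
  have mono: "x ^ (g_exp m + 1) \<le> x ^ (g_exp m' + 1)" if "m \<le> m'" for m m'
    using g_exp_mono[OF that] assms by (intro power_increasing) auto
  obtain N where "x + 1 < x ^ N" using real_arch_pow[OF assms] by blast
  also have "\<dots> \<le> x ^ (g_exp (Suc N) + 1)"
    using g_exp_ge[of "Suc N"] assms by (intro power_increasing) auto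
  finally have ex: "x + 1 \<le> x ^ (g_exp (Suc N) + 1)" by simp
  define n where "n = (LEAST n. x + 1 \<le> x ^ (g_exp (Suc n) + 1))"
  have n: "x + 1 \<le> x ^ (g_exp (Suc n) + 1)"
    unfolding n_def by (rule LeastI) (rule ex)
  have less: "x ^ (g_exp (Suc m) + 1) < x + 1" if "m < n" for m
    using not_less_Least[of m "\<lambda>n. x + 1 \<le> x ^ (g_exp (Suc n) + 1)"] that by (simp add: n_def)
  have lt: "ereal x < gamma_seq m \<longleftrightarrow> m \<le> n" for m
  proof (cases m)
    case 0
    then show ?thesis by (simp add: gamma_seq_def)
  next
    case (Suc m')
    have "x ^ (g_exp m + 1) < x + 1 \<longleftrightarrow> m \<le> n"
    proof (cases "m \<le> n")
      case True
      then show ?thesis using less[of m'] Suc by auto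
    next
      case False
      then have "x ^ (g_exp (Suc n) + 1) \<le> x ^ (g_exp m + 1)" by (intro mono) auto
      then show ?thesis using n False by linarith
    qed
    then show ?thesis using less_gamma_seq_iff[of x m] Suc assms by simp
  qed
  have "(THE n. gamma_seq (n + 1) \<le> ereal x \<and> ereal x < gamma_seq n) = n"
    unfolding linorder_not_less[symmetric] lt by (rule the_equality) auto
  then have "gap_set x = \<Union> (gap_family n x)" by (simp add: gap_set_def)
  then show ?thesis using less n by blast
qed


subsection \<open>Intervals under a skew tent map\<close>

lemma image_affine_open_interval:
  fixes h :: "real \<Rightarrow> real"
  assumes h: "\<And>z. h z = c * z + e" and "x < y"
  shows "h x < h y \<Longrightarrow> h ` {x<..<y} = {h x<..<h y}"
    and "h y < h x \<Longrightarrow> h ` {x<..<y} = {h y<..<h x}"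
proof -
  have inv: "w = h ((w - e) / c)" if "c \<noteq> 0" for w using that by (simp add: h)
  {
    assume "h x < h y"
    then have c: "c > 0" using \<open>x < y\<close> by (simp add: h mult_less_cancel_left)
    then have "w \<in> h ` {x<..<y}" if "w \<in> {h x<..<h y}" for w
      using that inv[of w] by (intro image_eqI[of _ _ "(w - e) / c"]) (auto simp: h field_simps)
    then show "h ` {x<..<y} = {h x<..<h y}" using c by (auto simp: h)
  next
    assume "h y < h x"
    then have c: "c < 0" using \<open>x < y\<close> by (simp add: h mult_less_cancel_left)
    then have "w \<in> h ` {x<..<y}" if "w \<in> {h y<..<h x}" for w
      using that inv[of w] by (intro image_eqI[of _ _ "(w - e) / c"]) (auto simp: h field_simps)
    then show "h ` {x<..<y} = {h y<..<h x}" using c by (auto simp: h)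
  }
qed

text \<open>Later \<open>P\<close> selects the positive intervals of a level; their ranks are the
  indices \<open>k\<close> of the gap intervals.\<close>

lemma rank_image:
  fixes P :: "nat \<Rightarrow> bool"
  shows "(\<lambda>i. \<Sum>j\<in>{1..<i}. of_bool (P j)) ` {i \<in> {1..N}. P i}
    = {..<(\<Sum>j\<in>{1..<Suc N}. of_bool (P j) :: nat)}"
proof (induction N)
  case (Suc N)
  have "{i \<in> {1..Suc N}. P i} = {i \<in> {1..N}. P i} \<union> (if P (Suc N) then {Suc N} else {})"
    by (auto simp: le_Suc_eq)
  moreover have "(\<Sum>j\<in>{1..<Suc (Suc N)}. of_bool (P j) :: nat)
    = (\<Sum>j\<in>{1..<Suc N}. of_bool (P j)) + of_bool (P (Suc N))"
    by (rule sum.atLeastLessThan_Suc) simp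
  ultimately show ?case using Suc.IH by (simp add: image_Un lessThan_Suc del: sum_of_bool_eq)
qed simp

text \<open>Returns to \<open>A\<close> are possible in times \<open>e\<close> and
  \<open>e + 1\<close>, so \<open>q\<close> of them realise every delay from \<open>q * e\<close> to
  \<open>q * e + q\<close>; from \<open>e * e\<close> on these ranges leave no holes.\<close>

lemma eventually_all_times:
  fixes A B :: "nat \<Rightarrow> bool"
  assumes AB: "\<And>t. A t \<Longrightarrow> B (t + r)" and BA: "\<And>t. B t \<Longrightarrow> A (t + r)" "\<And>t. B t \<Longrightarrow> A (t + l)"
    and consec: "l = Suc r \<or> r = Suc l" and r: "0 < r" and start: "A t\<^sub>0"
  shows "\<exists>N. \<forall>t\<ge>N. A t \<and> B t"
proof -
  define e where "e = min (r + r) (r + l)"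
  have e: "0 < e" using r by (simp add: e_def)
  have "A (t + (r + r))" "A (t + (r + l))" if "A t" for t
    using AB[OF that] BA by (metis add.assoc)+
  then have step: "A (t + e)" "A (t + Suc e)" if "A t" for t
    using that consec unfolding e_def by (auto simp: min_def)
  have reach: "s \<le> q \<Longrightarrow> A (t\<^sub>0 + q * e + s)" for q s
  proof (induction q arbitrary: s)
    case (Suc q)
    then show ?case
      using step(1)[OF Suc.IH[of s]] step(2)[OF Suc.IH[of "s - 1"]]
      by (cases "s \<le> q") (auto simp: algebra_simps le_Suc_eq)
  qed (use start in simp)
  have A: "A t" if "t \<ge> t\<^sub>0 + e * e" for t
  proof -
    have "e \<le> (t - t\<^sub>0) div e"
      using that e by (simp add: less_eq_div_iff_mult_less_eq)
    then have "(t - t\<^sub>0) mod e \<le> (t - t\<^sub>0) div e" using mod_less_divisor[OF e, of "t - t\<^sub>0"] by linarith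
    from reach[OF this] show ?thesis using that by (simp add: add.assoc)
  qed
  have "B t" if "t \<ge> t\<^sub>0 + e * e + r" for t
    using AB[OF A[of "t - r"]] that by simp
  then show ?thesis using A by (intro exI[of _ "t\<^sub>0 + e * e + r"]) auto
qed

text \<open>
  When an interval straddles the turning point, only the longer of its two images is kept, because
  the two halves take different times. This step and the next one together expand by at least
  \<open>a * b\<^sup>2 / (a + b)\<close>; in the borderline case \<open>a * b\<^sup>2 = a + b\<close> the expansion comes two steps later.
\<close>

lemma skew_tent_growth:
  fixes a b :: real and R :: "nat \<Rightarrow> real \<Rightarrow> real \<Rightarrow> bool"
  assumes a: "1 \<le> a" and b: "1 < b" and ab: "a * b \<le> a + b" and big: "a + b \<le> a * b ^ 2"
    and sub: "\<And>t x y x' y'. R t x y \<Longrightarrow> x \<le> x' \<Longrightarrow> y' \<le> y \<Longrightarrow> R t x' y'"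
    and right: "\<And>t x y. R t x y \<Longrightarrow> 0 \<le> x \<Longrightarrow> y \<le> 1 \<Longrightarrow> R (t + r) (1 - b * y) (1 - b * x)"
    and left: "\<And>t x y. R t x y \<Longrightarrow> 1 - b \<le> x \<Longrightarrow> y \<le> 0 \<Longrightarrow> R (t + l) (1 + a * x) (1 + a * y)"
    and start: "R t\<^sub>0 x\<^sub>0 y\<^sub>0" "1 - b \<le> x\<^sub>0" "x\<^sub>0 < y\<^sub>0" "y\<^sub>0 \<le> 1"
  shows "\<exists>t. R t (1 / (1 + b)) 1"
proof (rule ccontr)
  assume no: "\<not> ?thesis"
  \<comment> \<open>The contradiction will be a reached interval longer than the whole domain, so
    the times can be forgotten.\<close>
  define reach where "reach x y \<longleftrightarrow> 1 - b \<le> x \<and> x < y \<and> y \<le> 1 \<and> (\<exists>t. R t x y)" for x y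
  have reach_sub: "reach x' y'" if "reach x y" "x \<le> x'" "y' \<le> y" "x' < y'" for x y x' y'
    using that sub unfolding reach_def by (meson order_trans)
  have reach_right: "reach (1 - b * y) (1 - b * x)" if "reach x y" "0 \<le> x" for x y
    using that right b unfolding reach_def by (auto intro!: mult_nonneg_nonneg)
  have reach_left: "reach (1 + a * x) (1 + a * y)" if "reach x y" "y \<le> 0" for x y
  proof -
    have x: "1 - b \<le> x" "x < y" using that by (auto simp: reach_def)
    have "a * (1 - b) \<le> a * x" using x a by (intro mult_left_mono) auto
    then have "1 - b \<le> 1 + a * x" using ab by (simp add: algebra_simps)
    moreover have "a * x < a * y" "a * y \<le> 0" using x a that by (auto simp: mult_nonneg_nonpos)
    ultimately show ?thesis using that left unfolding reach_def by auto
  qed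
  have no_top: "\<not> reach x 1" if "x \<le> 1 / (1 + b)" for x
    using no sub[of _ x 1 "1 / (1 + b)" 1] that by (auto simp: reach_def)
  \<comment> \<open>The left branch sends \<open>{1 - b..0}\<close> onto
    \<open>{1 + a * (1 - b)..1}\<close>, which by \<open>big\<close> contains everything right of
    the fixed point \<open>1 / (1 + b)\<close>.\<close>
  have no_left: "\<not> (reach x y \<and> x \<le> 1 - b \<and> 0 \<le> y)" for x y
  proof
    assume *: "reach x y \<and> x \<le> 1 - b \<and> 0 \<le> y"
    then have "reach (1 - b) 0" using reach_sub[of x y "1 - b" 0] b by auto
    from reach_left[OF this] have "reach (1 + a * (1 - b)) 1" by simp
    moreover have "(1 + a * (1 - b)) * (1 + b) \<le> 1"
      using big by (simp add: algebra_simps power2_eq_square)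
    then have "1 + a * (1 - b) \<le> 1 / (1 + b)" using b by (simp add: field_simps)
    ultimately show False using no_top by blast
  qed
  define q where "q = (if a + b < a * b ^ 2 then a * b ^ 2 / (a + b) else b)"
  have q: "1 < q" using a b by (auto simp: q_def)
  have cross: "\<exists>x' y'. reach x' y' \<and> q * (y - x) \<le> y' - x'" if xy: "reach x y" "x < 0" "0 < y" for x y
  proof -
    define w where "w = min (1 + a * x) (1 - b * y)"
    have "reach (1 + a * x) 1" using reach_left[OF reach_sub[OF xy(1), of x 0]] xy by simp
    moreover have "reach (1 - b * y) 1" using reach_right[OF reach_sub[OF xy(1), of 0 y]] xy by simp
    ultimately have w: "reach w 1" by (simp add: w_def min_def)
    \<comment> \<open>The two images have lengths \<open>- a * x\<close> and \<open>b * y\<close>;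
      weighting them by \<open>b\<close> and \<open>a\<close> bounds the longer one from
      below.\<close>
    have len: "a * b * (y - x) \<le> (a + b) * (1 - w)"
    proof -
      have "- a * x \<le> 1 - w" "b * y \<le> 1 - w" by (auto simp: w_def)
      then have "b * (- a * x) \<le> b * (1 - w)" "a * (b * y) \<le> a * (1 - w)"
        using a b by (intro mult_left_mono; simp)+
      then show ?thesis by (simp add: algebra_simps)
    qed
    \<comment> \<open>If \<open>w\<close> were negative, the image of \<open>{0<..<1}\<close> at the
      next step would be the whole open domain.\<close>
    have w0: "0 \<le> w"
    proof (rule ccontr)
      assume "\<not> 0 \<le> w"
      then have "reach 0 1" using reach_sub[OF w, of 0 1] by simp
      from reach_right[OF this] show False using no_left[of "1 - b" 1] by simp
    qed
    define v where "v = 1 - b * w"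
    have v: "reach (1 - b) v" using reach_right[OF w w0] by (simp add: v_def)
    have v_neg: "v < 0" using no_left[of "1 - b" v] v by auto
    have len': "a * b ^ 2 * (y - x) \<le> (a + b) * (v - (1 - b))"
    proof -
      have "b * (a * b * (y - x)) \<le> b * ((a + b) * (1 - w))"
        using len b by (intro mult_left_mono) auto
      then show ?thesis by (simp add: v_def algebra_simps power2_eq_square)
    qed
    show ?thesis
    proof (cases "a + b < a * b ^ 2")
      case True
      then have "q * (y - x) \<le> v - (1 - b)" using len' a b by (simp add: q_def field_simps)
      then show ?thesis using v by blast
    next
      case False
      then have eq: "a * b ^ 2 = a + b" using big by simp
      have vl: "y - x \<le> v - (1 - b)" using len' a b unfolding eq by simp
      have u: "reach (1 + a * (1 - b)) (1 + a * v)" using reach_left[OF v] v_neg by simp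
      \<comment> \<open>In the borderline case the left end is sent exactly to the fixed point, so
        the image lies right of 0 and the right branch contributes another factor
        \<open>b\<close>.\<close>
      have "(1 + a * (1 - b)) * (1 + b) = 1"
        using eq by (simp add: algebra_simps power2_eq_square)
      then have "0 < 1 + a * (1 - b)" using b zero_less_mult_pos2[of "1 + a * (1 - b)" "1 + b"] by simp
      then have u': "reach (1 - b * (1 + a * v)) (1 - b * (1 + a * (1 - b)))"
        using reach_right[OF u] by simp
      have "b * (y - x) \<le> b * (v - (1 - b))" using vl b by simp
      also have "\<dots> \<le> b * (a * (v - (1 - b)))"
        using mult_right_mono[OF a, of "v - (1 - b)"] v b by (intro mult_left_mono) (auto simp: reach_def)
      finally have "q * (y - x) \<le> (1 - b * (1 + a * (1 - b))) - (1 - b * (1 + a * v))"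
        using False by (simp add: q_def algebra_simps)
      then show ?thesis using u' by blast
    qed
  qed
  \<comment> \<open>If \<open>a = 1\<close>, as at level 0, the left branch does not expand and must
    not enter the minimum.\<close>
  define k where "k = min q (min b (if a = 1 then b else a))"
  have k: "1 < k" "k \<le> q" "k \<le> b" using q a b by (auto simp: k_def)
  have right_or_cross: "\<exists>x' y'. reach x' y' \<and> k * (y - x) \<le> y' - x'" if xy: "reach x y" "0 < y" for x y
  proof -
    have pos: "0 \<le> y - x" using xy by (simp add: reach_def)
    show ?thesis
    proof (cases "0 \<le> x")
      case True
      have "k * (y - x) \<le> b * (y - x)" using k pos by (intro mult_right_mono) auto
      then have "k * (y - x) \<le> (1 - b * x) - (1 - b * y)" by (simp add: algebra_simps)
      then show ?thesis using reach_right[OF xy(1) True] by blast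
    next
      case False
      have "k * (y - x) \<le> q * (y - x)" using k pos by (intro mult_right_mono) auto
      then show ?thesis using cross[OF xy(1)] False xy by (meson not_le order_trans)
    qed
  qed
  have step: "\<exists>x' y'. reach x' y' \<and> k * (y - x) \<le> y' - x'" if xy: "reach x y" for x y
  proof (cases "0 < y")
    case True
    then show ?thesis using right_or_cross xy by blast
  next
    case False
    show ?thesis
    proof (cases "a = 1")
      case True
      \<comment> \<open>A left branch of slope 1 is a translation by 1: the length is kept until the
        upper end becomes positive.\<close>
      have shift: "\<exists>x' y'. reach x' y' \<and> 0 < y' \<and> y' - x' = y - x"
        if "reach x y" "- real i < y" for i x y
        using that
      proof (induction i arbitrary: x y)
        case (Suc i)
        show ?case
        proof (cases "0 < y")
          case False
          then have "reach (1 + x) (1 + y)" using reach_left[OF Suc.prems(1)] \<open>a = 1\<close> by simp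
          then show ?thesis using Suc.IH[of "1 + x" "1 + y"] Suc.prems by simp
        qed (use Suc.prems in blast)
      qed auto
      obtain i where "- y < real i" using reals_Archimedean2 by blast
      then show ?thesis using shift[OF xy, of i] right_or_cross by force
    next
      case False
      have "k * (y - x) \<le> a * (y - x)"
        using False xy by (intro mult_right_mono) (auto simp: k_def reach_def)
      then have "k * (y - x) \<le> (1 + a * y) - (1 + a * x)" by (simp add: algebra_simps)
      then show ?thesis using reach_left[OF xy] \<open>\<not> 0 < y\<close> by (meson not_less)
    qed
  qed
  have grow: "\<exists>x y. reach x y \<and> k ^ i * (y\<^sub>0 - x\<^sub>0) \<le> y - x" for i
  proof (induction i)
    case 0
    then show ?case using start by (auto simp: reach_def)
  next
    case (Suc i)
    then obtain x y where xy: "reach x y" "k ^ i * (y\<^sub>0 - x\<^sub>0) \<le> y - x" by blast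
    then have "k * (k ^ i * (y\<^sub>0 - x\<^sub>0)) \<le> k * (y - x)" using k by (intro mult_left_mono) auto
    then show ?case using step[OF xy(1)] by (auto simp: mult.assoc intro: order_trans)
  qed
  obtain i where "b / (y\<^sub>0 - x\<^sub>0) < k ^ i" using real_arch_pow[OF k(1)] by blast
  then have "b < k ^ i * (y\<^sub>0 - x\<^sub>0)" using start by (simp add: field_simps)
  moreover obtain x y where "reach x y" "k ^ i * (y\<^sub>0 - x\<^sub>0) \<le> y - x" using grow by blast
  ultimately show False by (auto simp: reach_def)
qed

subsection \<open>The skew tent map and its renormalizations\<close>

text \<open>Representative modulo 1 in \<open>{0<..1}\<close>. For \<open>y \<le> 1\<close> it is
  the first point of the \<open>F\<close>-orbit of \<open>y\<close> in that interval, since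
  \<open>F\<close> moves nonpositive points by 1.\<close>

definition unit_rep :: "real \<Rightarrow> real" where
  "unit_rep y = y - of_int \<lceil>y\<rceil> + 1"

lemma unit_rep_mem: "unit_rep y \<in> {0<..1}"
  unfolding unit_rep_def greaterThanAtMost_iff using ceiling_correct[of y] by linarith

lemma unit_rep_id: "y \<in> {0<..1} \<Longrightarrow> unit_rep y = y"
proof -
  assume "y \<in> {0<..1}"
  then have "\<lceil>y\<rceil> = 1" by (intro ceiling_unique) auto
  then show ?thesis by (simp add: unit_rep_def)
qed

lemma unit_rep_add_1: "unit_rep (1 + y) = unit_rep y"
  using ceiling_add_one[of y] by (simp add: unit_rep_def add.commute)

section \<open>The tent map \<open>F\<close> and its first return map\<close>

locale negative_beta =
  fixes \<beta> :: real
  assumes beta_gt_1: "1 < \<beta>"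
begin

abbreviation T :: "real \<Rightarrow> real" where
  "T \<equiv> neg_beta_map \<beta>"

definition F :: "real \<Rightarrow> real" where
  "F y = min (1 + y) (1 - \<beta> * y)"

lemma F_nonpos: "y \<le> 0 \<Longrightarrow> F y = 1 + y"
  unfolding F_def using mult_nonneg_nonpos[of \<beta> y] beta_gt_1 by auto

lemma F_nonneg: "0 \<le> y \<Longrightarrow> F y = 1 - \<beta> * y"
  unfolding F_def
proof (rule min_absorb2)
  assume "0 \<le> y"
  then have "0 \<le> \<beta> * y" using beta_gt_1 by simp
  then show "1 - \<beta> * y \<le> 1 + y" using \<open>0 \<le> y\<close> by linarith
qed

lemma F_le_1: "F y \<le> 1"
  using F_nonpos[of y] F_nonneg[of y] mult_nonneg_nonneg[of \<beta> y] beta_gt_1 by linarith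

lemma F_funpow_le_1: "y \<le> 1 \<Longrightarrow> (F ^^ i) y \<le> 1"
  by (cases i) (auto simp: F_le_1)

lemma unit_rep_F_pos:
  assumes "0 < y" "y \<le> 1"
  shows "unit_rep (F y) = T (unit_rep y)"
proof -
  have "\<lceil>1 - \<beta> * y\<rceil> = 1 - \<lfloor>\<beta> * y\<rfloor>" by (simp add: ceiling_def)
  then have "unit_rep (1 - \<beta> * y) = T y" by (simp add: unit_rep_def neg_beta_map_def)
  then show ?thesis using assms by (simp add: F_nonneg unit_rep_id)
qed

lemma unit_rep_F_nonpos: "y \<le> 0 \<Longrightarrow> unit_rep (F y) = unit_rep y"
  by (simp add: F_nonpos unit_rep_add_1)

definition time :: "nat \<Rightarrow> real \<Rightarrow> nat" where
  "time i y = (\<Sum>j<i. of_bool (0 < (F ^^ j) y))"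

lemma time_0 [simp]: "time 0 y = 0"
  by (simp add: time_def)

lemma time_Suc: "time (Suc i) y = time i y + of_bool (0 < (F ^^ i) y)"
  by (simp add: time_def)

lemma time_add: "time (i + j) y = time i y + time j ((F ^^ i) y)"
proof (induction j)
  case (Suc j)
  have "(F ^^ (i + j)) y = (F ^^ j) ((F ^^ i) y)" by (metis add.commute comp_apply funpow_add)
  then show ?case using Suc by (simp add: time_Suc)
qed simp

lemma time_le: "time i y \<le> i"
  by (induction i) (auto simp: time_Suc)

lemma unit_rep_F_funpow: "y \<le> 1 \<Longrightarrow> unit_rep ((F ^^ i) y) = (T ^^ time i y) (unit_rep y)"
proof (induction i)
  case (Suc i)
  then show ?case
    using unit_rep_F_pos[of "(F ^^ i) y"] unit_rep_F_nonpos[of "(F ^^ i) y"] F_funpow_le_1[of y i]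
    by (cases "0 < (F ^^ i) y") (auto simp: time_Suc)
qed auto

lemma unit_rep_eq_F_funpow:
  assumes "y \<le> 1"
  shows "\<exists>j. (F ^^ j) y = unit_rep y"
proof -
  have shift: "y + real j \<le> 1 \<Longrightarrow> (F ^^ j) y = y + real j" for j
    by (induction j) (auto simp: F_nonpos)
  have "\<lceil>y\<rceil> \<le> 1" using assms by (simp add: ceiling_le_one)
  then have "real (nat (1 - \<lceil>y\<rceil>)) = 1 - of_int \<lceil>y\<rceil>" by (subst of_nat_nat) auto
  then have "unit_rep y = y + real (nat (1 - \<lceil>y\<rceil>))" by (simp add: unit_rep_def)
  then show ?thesis using shift[of "nat (1 - \<lceil>y\<rceil>)"] unit_rep_mem[of y] by auto
qed

text \<open>The exponents are the \<open>T\<close>-times of the branches: \<open>2 ^ n\<close> steps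
  of \<open>F\<close> meet \<open>g_exp n\<close> positive points after the first point, which is
  itself positive on the right branch for even \<open>n\<close> and on the left branch for odd
  \<open>n\<close>, because the scaling \<open>d n\<close> alternates in sign.\<close>

definition a :: "nat \<Rightarrow> real" where "a n = \<beta> ^ (g_exp n + of_bool (odd n))"

definition b :: "nat \<Rightarrow> real" where "b n = \<beta> ^ (g_exp n + of_bool (even n))"

text \<open>The left branch of level \<open>Suc n\<close> runs through the right branch of level
  \<open>n\<close> twice; its right branch runs through each branch once.\<close>

lemma a_Suc: "a (Suc n) = b n ^ 2"
proof -
  have "g_exp (Suc n) + of_bool (odd (Suc n)) = (g_exp n + of_bool (even n)) * 2"
    by (auto simp: g_exp_Suc)
  then show ?thesis unfolding a_def b_def power_mult[symmetric] by (rule arg_cong)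
qed

lemma b_Suc: "b (Suc n) = a n * b n"
proof -
  have "g_exp (Suc n) + of_bool (even (Suc n))
    = (g_exp n + of_bool (odd n)) + (g_exp n + of_bool (even n))"
    by (auto simp: g_exp_Suc)
  then show ?thesis unfolding a_def b_def power_add[symmetric] by (rule arg_cong)
qed

lemma a_ge_1: "1 \<le> a n"
  unfolding a_def using beta_gt_1 by (intro one_le_power) auto

lemma b_gt_1: "1 < b n"
proof -
  have "g_exp n + of_bool (even n) > 0" using g_exp_ge[of n] by (cases "n = 0") auto
  then show ?thesis unfolding b_def using beta_gt_1 by (intro one_less_power) auto
qed

section \<open>Renormalization criterion and normalized tent maps\<close>

definition renormalizable :: "nat \<Rightarrow> bool" where
  "renormalizable n \<longleftrightarrow> a n * b n ^ 2 < a n + b n"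

text \<open>The common factor \<open>\<beta> ^ g_exp n\<close> cancels; what remains is the
  inequality for \<open>\<beta>\<close> below \<open>gamma_seq (Suc n)\<close>.\<close>

lemma renormalizable_iff: "renormalizable n \<longleftrightarrow> \<beta> ^ (g_exp (Suc n) + 1) < \<beta> + 1"
proof -
  define c where "c = \<beta> ^ g_exp n"
  have c: "c > 0" using beta_gt_1 by (simp add: c_def)
  have *: "c * u < c * v \<longleftrightarrow> u < v" for u v using c by simp
  have "a n * b n ^ 2 = c * \<beta> ^ (g_exp (Suc n) + 1)"
    by (cases "even n") (auto simp: a_def b_def c_def g_exp_Suc power_add power2_eq_square mult_2)
  moreover have "a n + b n = c * (\<beta> + 1)"
    by (cases "even n") (auto simp: a_def b_def c_def algebra_simps)
  ultimately show ?thesis unfolding renormalizable_def by (simp only: *)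
qed

text \<open>
  In the coordinate \<open>z = y / d n\<close>, the map \<open>F ^^ 2 ^ n\<close> is the skew tent map \<open>f n\<close> on \<open>D n\<close>. The
  intervals \<open>eL n ` D (Suc n)\<close> and \<open>eR n ` D (Suc n)\<close>, which \<open>f n\<close> swaps when level \<open>n\<close> is
  renormalizable, are the components of \<open>D n - gap n\<close>.
\<close>

definition f :: "nat \<Rightarrow> real \<Rightarrow> real" where
  "f n z = min (1 + a n * z) (1 - b n * z)"

definition D :: "nat \<Rightarrow> real set" where "D n = {1 - b n..1}"

text \<open>\<open>eL n\<close> fixes the turning point and reverses orientation, sending 1 to the
  left end of \<open>D n\<close>; \<open>eR n\<close> is \<open>eL n\<close> pulled back along the
  right branch of \<open>f n\<close>.\<close>

definition eR :: "nat \<Rightarrow> real \<Rightarrow> real" where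
  "eR n z = 1 + (b n - 1) / b n * (z - 1)"

definition eL :: "nat \<Rightarrow> real \<Rightarrow> real" where
  "eL n z = (1 - b n) * z"

text \<open>In the renormalizable case the ends are the fourth and the third image of the turning
  point 0 under \<open>f n\<close>.\<close>

definition gap :: "nat \<Rightarrow> real set" where
  "gap n = {(b n - 1) * (a n * b n - 1)<..<1 + a n - a n * b n}"

lemma f_neg: "z \<le> 0 \<Longrightarrow> f n z = 1 + a n * z"
  unfolding f_def using mult_nonneg_nonpos[of "a n" z] mult_nonneg_nonpos[of "b n" z]
    a_ge_1[of n] b_gt_1[of n] by auto

lemma f_pos: "0 \<le> z \<Longrightarrow> f n z = 1 - b n * z"
  unfolding f_def
proof (rule min_absorb2)
  assume "0 \<le> z"
  then have "0 \<le> a n * z" "0 \<le> b n * z" using a_ge_1[of n] b_gt_1[of n] by auto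
  then show "1 - b n * z \<le> 1 + a n * z" by linarith
qed

text \<open>Together with \<open>f_eR\<close> this makes \<open>eL n\<close> conjugate
  \<open>f (Suc n)\<close> to two steps of \<open>f n\<close>.\<close>

lemma f_eL: "f n (eL n z) = eR n (f (Suc n) z)"
proof -
  have b: "b n > 1" by (rule b_gt_1)
  show ?thesis
  proof (cases "0 \<le> z")
    case True
    then have "eL n z \<le> 0" using b by (simp add: eL_def mult_nonpos_nonneg)
    then show ?thesis using True b
      by (simp add: f_neg f_pos b_Suc eR_def eL_def field_simps)
  next
    case False
    then have "0 \<le> eL n z" using b by (simp add: eL_def mult_nonpos_nonpos)
    then show ?thesis using False b
      by (simp add: f_neg f_pos a_Suc eR_def eL_def field_simps power2_eq_square)
  qed
qed

text \<open>Geometrically: the image \<open>1 + a n - a n * b n\<close> of the left end lies right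
  of the fixed point \<open>1 / (1 + b n)\<close>.\<close>

lemma renormalizable_iff_fixpoint: "renormalizable n \<longleftrightarrow> 1 < (1 + b n) * (1 + a n - a n * b n)"
  unfolding renormalizable_def by (auto simp: algebra_simps power2_eq_square)

lemma right_end_pos: "renormalizable n \<Longrightarrow> 0 < 1 + a n - a n * b n"
  unfolding renormalizable_iff_fixpoint using b_gt_1[of n] zero_less_mult_pos[of "1 + b n" "1 + a n - a n * b n"] by auto

lemma ab_gt_1: "1 < a n * b n"
  using b_gt_1[of "Suc n"] by (simp add: b_Suc)

text \<open>The middle inequality is the renormalizability condition itself, rearranged.\<close>

lemma gap_bounds:
  assumes "renormalizable n"
  shows "0 < (b n - 1) * (a n * b n - 1)"
    "(b n - 1) * (a n * b n - 1) < 1 + a n - a n * b n"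
    "1 + a n - a n * b n < 1"
proof -
  show "0 < (b n - 1) * (a n * b n - 1)" using b_gt_1[of n] ab_gt_1[of n] by simp
  show "(b n - 1) * (a n * b n - 1) < 1 + a n - a n * b n"
    using assms unfolding renormalizable_def by (simp add: algebra_simps power2_eq_square)
  show "1 + a n - a n * b n < 1"
    using mult_strict_left_mono[of 1 "b n" "a n"] a_ge_1[of n] b_gt_1[of n] by simp
qed

lemma eR_image: "eR n ` D (Suc n) = {1 + a n - a n * b n..1}"
proof -
  have b: "b n > 1" by (rule b_gt_1)
  have "(\<exists>z\<in>D (Suc n). w = eR n z) \<longleftrightarrow> 1 + a n - a n * b n \<le> w \<and> w \<le> 1" for w
  proof -
    have *: "w = eR n z \<longleftrightarrow> z = 1 + b n * (w - 1) / (b n - 1)" for z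
      using b by (auto simp: eR_def field_simps)
    have "1 - a n * b n \<le> 1 + b n * (w - 1) / (b n - 1) \<longleftrightarrow> 1 + a n - a n * b n \<le> w"
    proof -
      have "1 - a n * b n \<le> 1 + b n * (w - 1) / (b n - 1) \<longleftrightarrow> b n * (a n * (1 - b n)) \<le> b n * (w - 1)"
        using b by (simp add: field_simps)
      also have "\<dots> \<longleftrightarrow> 1 + a n - a n * b n \<le> w"
        using b by (subst mult_le_cancel_left_pos) (auto simp: algebra_simps)
      finally show ?thesis .
    qed
    moreover have "1 + b n * (w - 1) / (b n - 1) \<le> 1 \<longleftrightarrow> w \<le> 1"
      using b by (auto simp: field_simps)
    ultimately show ?thesis unfolding * D_def b_Suc by auto
  qed
  then show ?thesis by (simp add: image_def set_eq_iff)
qed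

lemma eL_image: "eL n ` D (Suc n) = {1 - b n..(b n - 1) * (a n * b n - 1)}"
proof -
  have b: "b n > 1" by (rule b_gt_1)
  have "eL n ` D (Suc n) = {(1 - b n) * 1..(1 - b n) * (1 - a n * b n)}"
    unfolding eL_def D_def b_Suc using b ab_gt_1[of n]
    by (subst image_mult_atLeastAtMost_if) auto
  then show ?thesis by (simp add: algebra_simps)
qed

lemma D_split:
  assumes "renormalizable n"
  shows "D n = eL n ` D (Suc n) \<union> gap n \<union> eR n ` D (Suc n)"
  unfolding eR_image eL_image gap_def unfolding D_def
  using gap_bounds[OF assms] b_gt_1[of n] by auto

lemma eL_inj: "eL n z = eL n z' \<longleftrightarrow> z = z'"
  using b_gt_1[of n] by (simp add: eL_def)

lemma eR_inj: "eR n z = eR n z' \<longleftrightarrow> z = z'"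
  using b_gt_1[of n] by (simp add: eR_def)

lemma eL_neq_eR:
  assumes "renormalizable n" "z \<in> D (Suc n)" "z' \<in> D (Suc n)"
  shows "eL n z \<noteq> eR n z'"
proof -
  have "eL n z \<in> eL n ` D (Suc n)" "eR n z' \<in> eR n ` D (Suc n)" using assms by auto
  then show ?thesis unfolding eR_image eL_image using gap_bounds[OF assms(1)] by auto
qed

lemma eR_pos: "renormalizable n \<Longrightarrow> z \<in> D (Suc n) \<Longrightarrow> 0 < eR n z"
  using eR_image[of n] right_end_pos[of n] imageI[of z "D (Suc n)" "eR n"] by simp

lemma f_eR: "renormalizable n \<Longrightarrow> z \<in> D (Suc n) \<Longrightarrow> f n (eR n z) = eL n z"
  using eR_pos[of n z] b_gt_1[of n] by (simp add: f_pos eL_def eR_def field_simps)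

definition valid :: "nat \<Rightarrow> bool" where
  "valid n \<longleftrightarrow> (\<forall>m<n. renormalizable m)"

lemma valid_SucD: "valid (Suc n) \<Longrightarrow> valid n \<and> renormalizable n"
  by (auto simp: valid_def)

text \<open>This keeps the image of the left end inside \<open>D n\<close>. At a successor level it
  is the condition of the level below, multiplied by its \<open>b\<close>.\<close>

lemma ab_le: "valid n \<Longrightarrow> a n * b n \<le> a n + b n"
proof (cases n)
  case 0
  then show ?thesis by (simp add: a_def b_def g_exp_0)
next
  case (Suc m)
  assume "valid n"
  then have "b m * (a m * b m ^ 2) \<le> b m * (a m + b m)"
    using Suc b_gt_1[of m] by (intro mult_left_mono) (auto simp: valid_def renormalizable_def)
  then show ?thesis unfolding Suc a_Suc b_Suc by (simp add: algebra_simps power2_eq_square)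
qed

lemma f_mem:
  assumes "valid n" "z \<in> D n"
  shows "f n z \<in> D n"
proof (cases "0 \<le> z")
  case True
  then have "b n * z \<le> b n * 1" "0 \<le> b n * z"
    using assms b_gt_1[of n] by (auto simp: D_def)
  then show ?thesis using True by (simp add: f_pos D_def)
next
  case False
  then have "a n * (1 - b n) \<le> a n * z" "a n * z \<le> 0"
    using assms a_ge_1[of n] by (auto simp: D_def mult_nonneg_nonpos)
  then show ?thesis using False ab_le[OF assms(1)] by (simp add: f_neg D_def algebra_simps)
qed

lemma one_mem_D: "1 \<in> D n" and zero_mem_D: "0 \<in> D n" and left_mem_D: "1 - b n \<in> D n"
  using b_gt_1[of n] by (auto simp: D_def)

lemma f_surj:
  assumes "w \<in> D n"
  obtains z where "z \<in> D n" "f n z = w"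
proof -
  have "(1 - w) / b n \<in> {0..1}" using assms b_gt_1[of n] by (auto simp: D_def field_simps)
  then show ?thesis using b_gt_1[of n] by (intro that[of "(1 - w) / b n"]) (auto simp: D_def f_pos)
qed

section \<open>The cycle of intervals of a level\<close>

definition d :: "nat \<Rightarrow> real" where "d n = (\<Prod>j<n. 1 - b j)"

lemma d_Suc: "d (Suc n) = d n * (1 - b n)"
  by (simp add: d_def)

lemma d_sign: "0 < (- 1) ^ n * d n"
proof (induction n)
  case (Suc n)
  then have "0 < ((- 1) ^ n * d n) * (b n - 1)" using b_gt_1[of n] by simp
  then show ?case by (simp add: d_Suc algebra_simps)
qed (simp add: d_def)

lemma d_pos_iff: "0 < d n \<longleftrightarrow> even n" and d_neq_0: "d n \<noteq> 0"
  using d_sign[of n] by (cases "even n"; auto)+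

text \<open>Chart of the interval reached by \<open>i\<close> steps of \<open>F\<close> from the
  interval around the turning point, to which index \<open>2 ^ n\<close> returns. In level
  \<open>Suc n\<close> the first round visits the \<open>eR\<close> parts of the old intervals, the
  second round the \<open>eL\<close> parts.\<close>

primrec L :: "nat \<Rightarrow> nat \<Rightarrow> real \<Rightarrow> real" where
  "L 0 i z = z"
| "L (Suc n) i z = (if i \<le> 2 ^ n then L n i (eR n z) else L n (i - 2 ^ n) (eL n z))"

lemma L_top: "L n (2 ^ n) z = d n * z"
  by (induction n arbitrary: z) (auto simp: d_def eL_def)

lemma eL_mem: "renormalizable n \<Longrightarrow> z \<in> D (Suc n) \<Longrightarrow> eL n z \<in> D n"
  and eR_mem: "renormalizable n \<Longrightarrow> z \<in> D (Suc n) \<Longrightarrow> eR n z \<in> D n"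
  using D_split[of n] by auto

text \<open>A round of level \<open>Suc n\<close> is two rounds of level \<open>n\<close>, the first
  started in the \<open>eL\<close> part and the second in the \<open>eR\<close> part of the interval
  around 0.\<close>

lemma F_funpow_eq_L:
  assumes "valid n" "z \<in> D n" "i \<in> {1..2 ^ n}"
  shows "(F ^^ i) (d n * z) = L n i (f n z)"
  using assms
proof (induction n arbitrary: z i)
  case 0
  then show ?case by (simp add: d_def F_def f_def a_def b_def g_exp_0)
next
  case (Suc n)
  then have v: "valid n" "renormalizable n" by (auto dest: valid_SucD)
  note IH = Suc.IH[OF v(1)]
  have dz: "d (Suc n) * z = d n * eL n z" by (simp add: d_Suc eL_def)
  have z: "eL n z \<in> D n" using eL_mem v Suc.prems by auto
  have fz: "f (Suc n) z \<in> D (Suc n)" using f_mem Suc.prems by auto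
  show ?case
  proof (cases "i \<le> 2 ^ n")
    case True
    then show ?thesis using IH[OF z, of i] Suc.prems by (simp add: dz f_eL)
  next
    case False
    then have j: "i - 2 ^ n \<in> {1..2 ^ n}" "i = (i - 2 ^ n) + 2 ^ n" using Suc.prems by auto
    have "(F ^^ i) (d (Suc n) * z) = (F ^^ (i - 2 ^ n)) ((F ^^ (2 ^ n)) (d n * eL n z))"
      by (subst j(2)) (simp add: funpow_add dz)
    also have "(F ^^ (2 ^ n)) (d n * eL n z) = d n * eR n (f (Suc n) z)"
      using IH[OF z, of "2 ^ n"] by (simp add: L_top f_eL)
    also have "(F ^^ (i - 2 ^ n)) \<dots> = L n (i - 2 ^ n) (eL n (f (Suc n) z))"
      using IH[OF eR_mem[OF v(2) fz] j(1)] f_eR[OF v(2) fz] by simp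
    finally show ?thesis using False by simp
  qed
qed

lemma F_funpow_top:
  assumes "valid n" "z \<in> D n"
  shows "(F ^^ (2 ^ n)) (d n * z) = d n * f n z"
  using F_funpow_eq_L[OF assms, of "2 ^ n"] by (simp add: L_top)

lemma F_L_Suc:
  assumes "valid n" "w \<in> D n" "i \<in> {1..<2 ^ n}"
  shows "F (L n i w) = L n (Suc i) w"
proof -
  obtain z where z: "z \<in> D n" "f n z = w" using f_surj assms by blast
  show ?thesis
    using F_funpow_eq_L[OF assms(1) z(1), of i] F_funpow_eq_L[OF assms(1) z(1), of "Suc i"] assms z
    by simp
qed

lemma F_L_top:
  assumes "valid n" "w \<in> D n"
  shows "F (L n (2 ^ n) w) = L n 1 (f n w)"
  using F_funpow_eq_L[OF assms, of 1] by (simp add: L_top)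

lemma F_funpow_L:
  assumes "valid n" "w \<in> D n" "i \<ge> 1" "i + j \<le> 2 ^ n"
  shows "(F ^^ j) (L n i w) = L n (i + j) w"
  using assms(4)
proof (induction j)
  case (Suc j)
  then show ?case using F_L_Suc[OF assms(1,2), of "i + j"] assms(3) by simp
qed simp

text \<open>Only the last interval contains the turning point. At the next level its index
  \<open>2 ^ n\<close> denotes its \<open>eR\<close> part, which stays away from 0.\<close>

lemma L_same_sign:
  assumes "valid n" "z \<in> D n" "z' \<in> D n" "i \<in> {1..<2 ^ n}"
  shows "0 < L n i z * L n i z'"
  using assms
proof (induction n arbitrary: z z' i)
  case (Suc n)
  then have v: "valid n" "renormalizable n" by (auto dest: valid_SucD)
  note IH = Suc.IH[OF v(1)]
  note mem = eR_mem[OF v(2)] eL_mem[OF v(2)]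
  consider "i < 2 ^ n" | "i = 2 ^ n" | "2 ^ n < i" by linarith
  then show ?case
  proof cases
    case 1
    then show ?thesis using IH[OF mem(1) mem(1)] Suc.prems by auto
  next
    case 2
    have "0 < d n * d n" using d_neq_0[of n] by (metis not_real_square_gt_zero)
    then have "0 < (d n * d n) * (eR n z * eR n z')"
      using eR_pos[OF v(2)] Suc.prems by simp
    then show ?thesis using 2 by (simp add: L_top algebra_simps)
  next
    case 3
    then have "i - 2 ^ n \<in> {1..<2 ^ n}" using Suc.prems by auto
    then show ?thesis using IH[OF mem(2) mem(2), of z z' "i - 2 ^ n"] Suc.prems 3 by auto
  qed
qed simp

lemma L_pos_iff:
  assumes "valid n" "z \<in> D n" "z' \<in> D n" "i \<in> {1..<2 ^ n}"
  shows "0 < L n i z \<longleftrightarrow> 0 < L n i z'"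
  using L_same_sign[OF assms] by (auto simp: zero_less_mult_iff)

text \<open>Counting starts at index 1, since only the sign of the starting point depends on its
  coordinate. These counts become the indices \<open>k\<close> of the gap intervals.\<close>

definition itin :: "nat \<Rightarrow> nat \<Rightarrow> nat" where
  "itin n i = (\<Sum>j\<in>{1..<i}. of_bool (0 < L n j 1))"

lemma itin_Suc: "i \<ge> 1 \<Longrightarrow> itin n (Suc i) = itin n i + of_bool (0 < L n i 1)"
  by (simp add: itin_def)

lemma itin_1: "itin n (Suc 0) = 0"
  by (simp add: itin_def)

text \<open>Each of the two rounds contributes \<open>g_exp n\<close>, and the interval of index
  \<open>2 ^ n\<close> between them is positive exactly for even \<open>n\<close>.\<close>

lemma itin_top: "valid n \<Longrightarrow> itin n (2 ^ n) = g_exp n"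
proof (induction n)
  case 0
  then show ?case by (simp add: itin_def g_exp_0)
next
  case (Suc n)
  then have v: "valid n" "renormalizable n" by (auto dest: valid_SucD)
  have eR1: "eR n 1 = 1" by (simp add: eR_def)
  have "itin (Suc n) (2 ^ Suc n) = (\<Sum>j\<in>{1..<2 ^ n}. of_bool (0 < L (Suc n) j 1))
      + (\<Sum>j\<in>{2 ^ n..<2 ^ n + 2 ^ n}. of_bool (0 < L (Suc n) j 1))"
    unfolding itin_def by (subst sum.atLeastLessThan_concat) (auto simp: mult_2)
  also have "(\<Sum>j\<in>{2 ^ n..<2 ^ n + 2 ^ n}. of_bool (0 < L (Suc n) j 1) :: nat)
    = of_bool (0 < L (Suc n) (2 ^ n) 1)
      + (\<Sum>j\<in>{Suc (2 ^ n)..<2 ^ n + 2 ^ n}. of_bool (0 < L (Suc n) j 1))"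
    by (rule sum.atLeast_Suc_lessThan) simp
  also have "(\<Sum>j\<in>{1..<2 ^ n}. of_bool (0 < L (Suc n) j 1)) = itin n (2 ^ n)"
    unfolding itin_def by (intro sum.cong) (auto simp: eR1)
  also have "(\<Sum>j\<in>{Suc (2 ^ n)..<2 ^ n + 2 ^ n}. of_bool (0 < L (Suc n) j 1)) = itin n (2 ^ n)"
  proof -
    have "(\<Sum>j\<in>{Suc (2 ^ n)..<2 ^ n + 2 ^ n}. of_bool (0 < L (Suc n) j 1))
      = (\<Sum>j\<in>{1..<2 ^ n}. of_bool (0 < L (Suc n) (j + 2 ^ n) 1))"
      unfolding Suc_eq_plus1_left by (rule sum.shift_bounds_nat_ivl)
    also have "\<dots> = itin n (2 ^ n)"
      unfolding itin_def
      using L_pos_iff[OF v(1) eL_mem[OF v(2) one_mem_D] one_mem_D]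
      by (intro sum.cong) auto
    finally show ?thesis .
  qed
  also have "of_bool (0 < L (Suc n) (2 ^ n) 1) = (of_bool (even n) :: nat)"
    by (simp add: L_top eR1 d_pos_iff)
  finally show ?case using Suc v by (simp add: g_exp_Suc)
qed

lemma time_eq_itin:
  assumes "valid n" "z \<in> D n" "i \<in> {1..2 ^ n}"
  shows "time i (d n * z) = of_bool (0 < d n * z) + itin n i"
proof -
  have "{..<i} = insert 0 {1..<i}" using assms by auto
  then have "time i (d n * z)
    = of_bool (0 < d n * z) + (\<Sum>j\<in>{1..<i}. of_bool (0 < (F ^^ j) (d n * z)))"
    by (simp add: time_def)
  also have "(\<Sum>j\<in>{1..<i}. of_bool (0 < (F ^^ j) (d n * z))) = itin n i"
    unfolding itin_def using assms F_funpow_eq_L[OF assms(1,2)]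
      L_pos_iff[OF assms(1) f_mem[OF assms(1,2)] one_mem_D]
    by (intro sum.cong) auto
  finally show ?thesis .
qed

lemma time_top:
  assumes "valid n" "z \<in> D n"
  shows "time (2 ^ n) (d n * z) = g_exp n + of_bool (0 < d n * z)"
  using time_eq_itin[OF assms, of "2 ^ n"] itin_top[OF assms(1)] by simp

lemma L_1_strict_mono: "z < z' \<Longrightarrow> L n (Suc 0) z < L n (Suc 0) z'"
proof (induction n arbitrary: z z')
  case (Suc n)
  have "eR n z < eR n z'" using Suc.prems b_gt_1[of n] by (simp add: eR_def divide_strict_right_mono)
  then show ?case using Suc.IH by simp
qed simp

text \<open>\<open>F\<close> reverses order exactly on the positive intervals, so the parity of
  \<open>itin n i\<close> decides the orientation; hence the case split on \<open>k\<close> in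
  \<open>gap_interval\<close>.\<close>

lemma L_orientation:
  assumes "valid n" "z \<in> D n" "z' \<in> D n" "z < z'" "i \<in> {1..2 ^ n}"
  shows "0 < (- 1) ^ itin n i * (L n i z' - L n i z)"
  using assms(5)
proof (induction i)
  case (Suc i)
  show ?case
  proof (cases "i = 0")
    case True
    then show ?thesis using L_1_strict_mono[OF assms(4)] by (simp add: itin_1)
  next
    case False
    then have i: "i \<in> {1..<2 ^ n}" "i \<ge> 1" using Suc.prems by auto
    have IH: "0 < (- 1) ^ itin n i * (L n i z' - L n i z)" using Suc i by auto
    note L = F_L_Suc[OF assms(1,2) i(1), symmetric] F_L_Suc[OF assms(1,3) i(1), symmetric]
    note s = L_pos_iff[OF assms(1,2) one_mem_D i(1)] L_pos_iff[OF assms(1,3) one_mem_D i(1)]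
    show ?thesis
    proof (cases "0 < L n i 1")
      case True
      have "0 < \<beta> * ((- 1) ^ itin n i * (L n i z' - L n i z))" using IH beta_gt_1 by simp
      then show ?thesis using True s itin_Suc[OF i(2)] by (simp add: L F_nonneg algebra_simps)
    next
      case False
      then show ?thesis using IH s itin_Suc[OF i(2)] by (simp add: L F_nonpos not_less)
    qed
  qed
qed simp

section \<open>Nested invariant sets and the gaps between them\<close>

definition K :: "nat \<Rightarrow> real set" where
  "K n = (\<Union>i\<in>{1..2 ^ n}. L n i ` D n)"

definition gaps :: "nat \<Rightarrow> real set" where
  "gaps n = (\<Union>i\<in>{1..2 ^ n}. L n i ` gap n)"

lemma L_inj:
  assumes "valid n" "i \<in> {1..2 ^ n}" "j \<in> {1..2 ^ n}" "z \<in> D n" "w \<in> D n" "L n i z = L n j w"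
  shows "i = j \<and> z = w"
  using assms
proof (induction n arbitrary: i j z w)
  case (Suc n)
  then have v: "valid n" "renormalizable n" by (auto dest: valid_SucD)
  note IH = Suc.IH[OF v(1)]
  note mem = eR_mem[OF v(2)] eL_mem[OF v(2)]
  note ne = eL_neq_eR[OF v(2)]
  have zw: "z \<in> D (Suc n)" "w \<in> D (Suc n)" using Suc.prems by auto
  have range: "k \<in> {1..2 ^ n}" if "k \<in> {1..2 ^ Suc n}" "k \<le> 2 ^ n" for k :: nat
    using that by auto
  have range': "k - 2 ^ n \<in> {1..2 ^ n}" if "k \<in> {1..2 ^ Suc n}" "\<not> k \<le> 2 ^ n" for k :: nat
    using that by auto
  note eq = Suc.prems(6)
  show ?case
  proof (cases "i \<le> 2 ^ n"; cases "j \<le> 2 ^ n")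
    assume ij: "i \<le> 2 ^ n" "j \<le> 2 ^ n"
    show ?thesis
      using IH[OF range[OF Suc.prems(2) ij(1)] range[OF Suc.prems(3) ij(2)] mem(1)[OF zw(1)] mem(1)[OF zw(2)]]
        eq ij by (simp add: eR_inj)
  next
    assume ij: "i \<le> 2 ^ n" "\<not> j \<le> 2 ^ n"
    show ?thesis
      using IH[OF range[OF Suc.prems(2) ij(1)] range'[OF Suc.prems(3) ij(2)] mem(1)[OF zw(1)] mem(2)[OF zw(2)]]
        eq ij ne[OF zw(2) zw(1)] by simp
  next
    assume ij: "\<not> i \<le> 2 ^ n" "j \<le> 2 ^ n"
    show ?thesis
      using IH[OF range'[OF Suc.prems(2) ij(1)] range[OF Suc.prems(3) ij(2)] mem(2)[OF zw(1)] mem(1)[OF zw(2)]]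
        eq ij ne[OF zw(1) zw(2)] by simp
  next
    assume ij: "\<not> i \<le> 2 ^ n" "\<not> j \<le> 2 ^ n"
    show ?thesis
      using IH[OF range'[OF Suc.prems(2) ij(1)] range'[OF Suc.prems(3) ij(2)] mem(2)[OF zw(1)] mem(2)[OF zw(2)]]
        eq ij by (simp add: eL_inj eq_diff_iff)
  qed
qed auto

lemma K_0: "K 0 = {1 - \<beta>..1}"
  by (simp add: K_def D_def b_def g_exp_0)

text \<open>The interval \<open>i\<close> of level \<open>n\<close> contains the intervals
  \<open>i\<close> and \<open>i + 2 ^ n\<close> of level \<open>Suc n\<close>.\<close>

lemma K_Suc: "K (Suc n) = (\<Union>i\<in>{1..2 ^ n}. L n i ` (eL n ` D (Suc n) \<union> eR n ` D (Suc n)))"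
proof -
  have *: "{1..2 ^ Suc n} = {1..2 ^ n} \<union> (\<lambda>i. i + 2 ^ n) ` {1..(2::nat) ^ n}"
    by (auto simp: image_iff)
  have 1: "L (Suc n) i ` D (Suc n) = L n i ` eR n ` D (Suc n)" if "i \<le> 2 ^ n" for i
    using that by (force simp: image_iff)
  have 2: "L (Suc n) (i + 2 ^ n) ` D (Suc n) = L n i ` eL n ` D (Suc n)" if "1 \<le> i" for i
    using that by (force simp: image_iff)
  have "K (Suc n) = (\<Union>i\<in>{1..2 ^ n}. L (Suc n) i ` D (Suc n))
      \<union> (\<Union>i\<in>{1..2 ^ n}. L (Suc n) (i + 2 ^ n) ` D (Suc n))"
    unfolding K_def * by (simp only: UN_Un image_image UN_simps)
  also have "\<dots> = (\<Union>i\<in>{1..2 ^ n}. L n i ` eR n ` D (Suc n))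
      \<union> (\<Union>i\<in>{1..2 ^ n}. L n i ` eL n ` D (Suc n))"
    by (intro arg_cong2[of _ _ _ _ "(\<union>)"] SUP_cong refl 1 2) auto
  finally show ?thesis by (simp only: image_Un UN_Un_distrib Un_commute)
qed

lemma K_split:
  assumes "renormalizable n"
  shows "K n = K (Suc n) \<union> gaps n"
  unfolding K_def[of n] D_split[OF assms] K_Suc gaps_def image_Un UN_Un_distrib
  by (simp only: Un_ac)

lemma K_gaps_disjoint:
  assumes "valid (Suc n)"
  shows "K (Suc n) \<inter> gaps n = {}"
proof -
  have v: "valid n" "renormalizable n" using assms by (auto dest: valid_SucD)
  have "eL n ` D (Suc n) \<inter> gap n = {}" "eR n ` D (Suc n) \<inter> gap n = {}"
    unfolding eL_image eR_image gap_def by auto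
  then have disj: "(eL n ` D (Suc n) \<union> eR n ` D (Suc n)) \<inter> gap n = {}" by blast
  have sub: "eL n ` D (Suc n) \<union> eR n ` D (Suc n) \<subseteq> D n" "gap n \<subseteq> D n"
    unfolding D_split[OF v(2)] by auto
  have False if x: "x \<in> K (Suc n)" "x \<in> gaps n" for x
  proof -
    obtain i z where i: "i \<in> {1..2 ^ n}" "z \<in> eL n ` D (Suc n) \<union> eR n ` D (Suc n)" "x = L n i z"
      using x(1) unfolding K_Suc by blast
    obtain j w where j: "j \<in> {1..2 ^ n}" "w \<in> gap n" "x = L n j w"
      using x(2) unfolding gaps_def by blast
    have "z \<in> D n" "w \<in> D n" using i(2) j(2) sub by auto
    then have "z = w" using L_inj[OF v(1) i(1) j(1), of z w] i(3) j(3) by simp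
    then show False using i(2) j(2) disj by blast
  qed
  then show ?thesis by blast
qed

lemma K_partition: "valid n \<Longrightarrow> K n = {1 - \<beta>..1} - (\<Union>m<n. gaps m)"
proof (induction n)
  case (Suc n)
  then have "valid n" "renormalizable n" by (auto dest: valid_SucD)
  then show ?case
    using Suc.IH K_split[of n] K_gaps_disjoint[OF Suc.prems] by (auto simp: lessThan_Suc)
qed (simp add: K_0)

lemma F_K:
  assumes "valid n" "y \<in> K n"
  shows "F y \<in> K n"
proof -
  obtain i w where y: "i \<in> {1..2 ^ n}" "w \<in> D n" "y = L n i w" using assms by (auto simp: K_def)
  show ?thesis
  proof (cases "i = 2 ^ n")
    case True
    then show ?thesis using F_L_top[OF assms(1) y(2)] f_mem[OF assms(1) y(2)] y by (force simp: K_def)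
  next
    case False
    then show ?thesis using F_L_Suc[OF assms(1) y(2), of i] y by (force simp: K_def)
  qed
qed

lemma F_funpow_K: "valid n \<Longrightarrow> y \<in> K n \<Longrightarrow> (F ^^ i) y \<in> K n"
  by (induction i) (auto simp: F_K)

lemma unit_rep_K:
  assumes "valid n" "y \<in> K n"
  shows "unit_rep y \<in> K n"
proof -
  have "y \<le> 1" using K_partition[OF assms(1)] assms(2) by auto
  then show ?thesis using unit_rep_eq_F_funpow[of y] F_funpow_K[OF assms] by metis
qed

lemma T_K:
  assumes "valid n" "x \<in> K n" "x \<in> {0<..1}"
  shows "T x \<in> K n"
  using unit_rep_F_pos[of x] unit_rep_id[of x] unit_rep_K[OF assms(1) F_K[OF assms(1,2)]] assms(3)
  by auto

subsection \<open>Identification of the gaps with those of the critical orbit\<close>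

lemma gap_subset_D: "renormalizable n \<Longrightarrow> gap n \<subseteq> D n"
  using D_split[of n] by auto

lemma gap_ends_mem_D:
  assumes "renormalizable n"
  shows "(b n - 1) * (a n * b n - 1) \<in> D n" "1 + a n - a n * b n \<in> D n"
  using gap_bounds[OF assms] b_gt_1[of n] by (auto simp: D_def)

text \<open>Gaps lie right of the turning point, so even on the last interval the sign is constant
  along them.\<close>

lemma L_pos_right:
  assumes "valid n" "i \<in> {1..2 ^ n}" "z \<in> D n" "0 < z"
  shows "0 < L n i z \<longleftrightarrow> 0 < L n i 1"
proof (cases "i = 2 ^ n")
  case True
  then show ?thesis using assms by (simp add: L_top zero_less_mult_iff)
next
  case False
  then show ?thesis using L_pos_iff[OF assms(1,3) one_mem_D] assms by simp
qed

lemma L_affine: "\<exists>c e. \<forall>z. L n i z = c * z + e"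
proof (induction n arbitrary: i)
  case 0
  show ?case by (intro exI[of _ 1] exI[of _ 0]) simp
next
  case (Suc n)
  show ?case
  proof (cases "i \<le> 2 ^ n")
    case True
    obtain c e where "\<forall>z. L n i z = c * z + e" using Suc.IH by blast
    moreover define q where "q = (b n - 1) / b n"
    ultimately show ?thesis using True
      by (intro exI[of _ "c * q"] exI[of _ "c * (1 - q) + e"])
        (simp add: eR_def q_def[symmetric] algebra_simps)
  next
    case False
    obtain c e where "\<forall>z. L n (i - 2 ^ n) z = c * z + e" using Suc.IH by blast
    then show ?thesis using False
      by (intro exI[of _ "c * (1 - b n)"] exI[of _ e]) (simp add: eL_def)
  qed
qed

lemma T_orbit_of_1: "unit_rep ((F ^^ i) 0) = (T ^^ time i 0) 1"
  using unit_rep_F_funpow[of 0 i] by (simp add: unit_rep_def)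

text \<open>As \<open>unit_rep 0 = 1\<close>, the \<open>T\<close>-orbit of 1 follows the
  \<open>F\<close>-orbit of 0. Rounds of \<open>2 ^ n\<close> steps lead, in the chart, from 0 to 1,
  \<open>1 - b n\<close> and the upper gap end; \<open>i\<close> further steps from the last two
  give the two claims, and the exponents add up the times.\<close>

lemma critical_orbit:
  assumes "valid n" "renormalizable n" "i \<in> {1..2 ^ n}"
  shows "unit_rep (L n i (1 + a n - a n * b n)) = (T ^^ (gap_exp n + itin n i)) 1"
    and "unit_rep (L n i ((b n - 1) * (a n * b n - 1))) = (T ^^ (2 ^ (n + 1) + itin n i)) 1"
proof -
  let ?N = "2 ^ n :: nat" and ?y = "d n * (1 - b n)" and ?w = "1 + a n - a n * b n"
  have f1: "f n 1 = 1 - b n" by (simp add: f_pos)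
  have fl: "f n (1 - b n) = ?w" using b_gt_1[of n] by (simp add: f_neg algebra_simps)
  have fw: "f n ?w = (b n - 1) * (a n * b n - 1)"
    using right_end_pos[OF assms(2)] by (simp add: f_pos algebra_simps)
  note w = gap_ends_mem_D(2)[OF assms(2)]
  note top = F_funpow_top[OF assms(1)] and tt = time_top[OF assms(1)]
  have F1: "(F ^^ ?N) 0 = d n" using top[OF zero_mem_D] by (simp add: f_pos)
  have F2: "(F ^^ ?N) (d n) = ?y" using top[OF one_mem_D] by (simp add: f1)
  have F3: "(F ^^ ?N) ?y = d n * ?w" using top[OF left_mem_D] by (simp add: fl)
  have t1: "time ?N 0 = g_exp n" using tt[OF zero_mem_D] by simp
  have t2: "time ?N (d n) = g_exp n + of_bool (even n)" using tt[OF one_mem_D] by (simp add: d_pos_iff)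
  have y_pos: "0 < ?y \<longleftrightarrow> odd n"
    using b_gt_1[of n] d_neq_0[of n] d_pos_iff[of n] by (auto simp: zero_less_mult_iff)
  have w_pos: "0 < d n * ?w \<longleftrightarrow> even n"
    using right_end_pos[OF assms(2)] by (simp add: zero_less_mult_iff d_pos_iff)
  have t3: "time ?N ?y = g_exp n + of_bool (odd n)" using tt[OF left_mem_D] by (simp add: y_pos)
  have ti: "time i ?y = of_bool (odd n) + itin n i"
    using time_eq_itin[OF assms(1) left_mem_D assms(3)] by (simp add: y_pos)
  have ti': "time i (d n * ?w) = of_bool (even n) + itin n i"
    using time_eq_itin[OF assms(1) w assms(3)] by (simp add: w_pos)
  have F_orbit: "(F ^^ (?N + ?N)) 0 = ?y" "(F ^^ (?N + ?N + ?N)) 0 = d n * ?w"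
    by (simp_all add: funpow_add F1 F2 F3)
  have t_orbit: "time (?N + ?N) 0 = g_exp (Suc n)"
    "time (?N + ?N + ?N) 0 = g_exp (Suc n) + g_exp n + of_bool (odd n)"
    by (simp_all add: time_add F1 F_orbit(1) t1 t2 t3 g_exp_Suc)
  have "(F ^^ (i + (?N + ?N))) 0 = L n i ?w"
    unfolding funpow_add[of i] comp_apply F_orbit
    using F_funpow_eq_L[OF assms(1) left_mem_D assms(3)] by (simp add: fl)
  moreover have "time (?N + ?N + i) 0 = gap_exp n + itin n i"
    unfolding time_add[of "?N + ?N"] t_orbit F_orbit ti gap_exp_eq by simp
  ultimately show "unit_rep (L n i ?w) = (T ^^ (gap_exp n + itin n i)) 1"
    using T_orbit_of_1[of "?N + ?N + i"] by (simp add: add.commute)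
  have "(F ^^ (i + (?N + ?N + ?N))) 0 = L n i ((b n - 1) * (a n * b n - 1))"
    unfolding funpow_add[of i] comp_apply F_orbit
    using F_funpow_eq_L[OF assms(1) w assms(3)] by (simp only: fw)
  moreover have "time (?N + ?N + ?N + i) 0 = 2 ^ (n + 1) + itin n i"
    unfolding time_add[of "?N + ?N + ?N"] t_orbit F_orbit ti' g_exp_add_Suc[symmetric] by simp
  ultimately show "unit_rep (L n i ((b n - 1) * (a n * b n - 1))) = (T ^^ (2 ^ (n + 1) + itin n i)) 1"
    using T_orbit_of_1[of "?N + ?N + ?N + i"] by (simp only: add.commute[of i])
qed

lemma L_le_1:
  assumes "valid n" "i \<in> {1..2 ^ n}" "z \<in> D n"
  shows "L n i z \<le> 1"
proof -
  have "L n i z \<in> K n" using assms by (auto simp: K_def)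
  then show ?thesis using K_partition[OF assms(1)] by auto
qed

lemma gap_interval_eq:
  assumes "valid n" "renormalizable n" "i \<in> {1..2 ^ n}" "0 < L n i 1"
  shows "gap_interval \<beta> n (itin n i) = L n i ` gap n"
proof -
  let ?v = "(b n - 1) * (a n * b n - 1)" and ?w = "1 + a n - a n * b n"
  note D = gap_ends_mem_D[OF assms(2)] and bounds = gap_bounds[OF assms(2)]
  \<comment> \<open>On a positive interval these points already lie in
    \<open>{0<..1}\<close>.\<close>
  have "unit_rep (L n i z) = L n i z" if "z \<in> D n" "0 < z" for z
    using L_pos_right[OF assms(1,3) that] L_le_1[OF assms(1,3) that(1)] assms(4)
    by (intro unit_rep_id) simp
  then have ends: "(T ^^ (gap_exp n + itin n i)) 1 = L n i ?w" "(T ^^ (2 ^ (n + 1) + itin n i)) 1 = L n i ?v"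
    using critical_orbit[OF assms(1-3)] D bounds by auto
  obtain c e where ce: "\<And>z. L n i z = c * z + e" using L_affine by blast
  note image = image_affine_open_interval[OF ce bounds(2)]
  have ori: "0 < (- 1) ^ itin n i * (L n i ?w - L n i ?v)"
    by (rule L_orientation[OF assms(1) D bounds(2) assms(3)])
  show ?thesis
  proof (cases "even (itin n i)")
    case True
    then show ?thesis using ori image(1) unfolding gap_interval_def ends gap_def Let_def by simp
  next
    case False
    then show ?thesis using ori image(2) unfolding gap_interval_def ends gap_def Let_def by simp
  qed
qed

lemma itin_image:
  assumes "valid n"
  shows "itin n ` {i \<in> {1..2 ^ n}. 0 < L n i 1} = {..<g_exp n + of_bool (even n)}"
proof -
  \<comment> \<open>\<open>itin n (2 ^ n)\<close> leaves out the last interval, which at coordinate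
    1 is positive for even \<open>n\<close>.\<close>
  have "(\<Sum>j\<in>{1..<Suc (2 ^ n)}. of_bool (0 < L n j 1)) = g_exp n + of_bool (even n)"
    using itin_Suc[of "2 ^ n" n] itin_top[OF assms] by (simp add: itin_def L_top d_pos_iff)
  moreover have "itin n = (\<lambda>i. \<Sum>j\<in>{1..<i}. of_bool (0 < L n j 1))"
    by (simp only: itin_def fun_eq_iff simp_thms)
  ultimately show ?thesis using rank_image[of "\<lambda>j. 0 < L n j 1" "2 ^ n"] by simp
qed

lemma Union_gap_intervals:
  assumes "valid n" "renormalizable n"
  shows "(\<Union>k<g_exp n + of_bool (even n). gap_interval \<beta> n k) = gaps n \<inter> {0<..}"
proof -
  have "(\<Union>k<g_exp n + of_bool (even n). gap_interval \<beta> n k)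
    = (\<Union>i\<in>{i \<in> {1..2 ^ n}. 0 < L n i 1}. gap_interval \<beta> n (itin n i))"
    unfolding itin_image[OF assms(1), symmetric] by (simp only: image_image)
  also have "\<dots> = (\<Union>i\<in>{i \<in> {1..2 ^ n}. 0 < L n i 1}. L n i ` gap n)"
    using gap_interval_eq[OF assms] by (intro SUP_cong) auto
  also have "\<dots> = gaps n \<inter> {0<..}"
  proof -
    have "0 < z" if "z \<in> gap n" for z using that gap_bounds(1)[OF assms(2)] by (simp add: gap_def)
    then have "0 < L n i z \<longleftrightarrow> 0 < L n i 1" if "i \<in> {1..2 ^ n}" "z \<in> gap n" for i z
      using L_pos_right[OF assms(1) that(1)] gap_subset_D[OF assms(2)] that by blast
    then show ?thesis by (auto simp: gaps_def)
  qed
  finally show ?thesis .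
qed

lemma Union_gap_family:
  assumes "valid n"
  shows "\<Union> (gap_family n \<beta>) = (\<Union>m<n. gaps m) \<inter> {0<..}"
proof -
  have count: "real k < (2 ^ (m + 1) + (- 1) ^ m) / 3 \<longleftrightarrow> k < g_exp m + of_bool (even m)" for k m
    unfolding of_nat_gap_count[symmetric] by (rule of_nat_less_iff)
  have "\<Union> (gap_family n \<beta>) = (\<Union>m<n. \<Union>k<g_exp m + of_bool (even m). gap_interval \<beta> m k)"
    unfolding gap_family_def count by (blast intro: lessThan_iff[THEN iffD2])
  also have "\<dots> = (\<Union>m<n. gaps m \<inter> {0<..})"
    using assms by (intro SUP_cong refl Union_gap_intervals) (auto simp: valid_def)
  finally show ?thesis by auto
qed

subsection \<open>Points that stay in the gaps\<close>

text \<open>The fixed point of the right branch; \<open>d n * p n\<close> is then periodic under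
  \<open>F\<close> at valid levels.\<close>

definition p :: "nat \<Rightarrow> real" where "p n = 1 / (1 + b n)"

lemma p_bounds: "0 < p n" "p n < 1"
  using b_gt_1[of n] by (auto simp: p_def)

lemma f_minus_p: "0 \<le> z \<Longrightarrow> f n z - p n = - b n * (z - p n)"
  using b_gt_1[of n] by (simp add: f_pos p_def field_simps)

lemma f_funpow_mem: "valid n \<Longrightarrow> z \<in> D n \<Longrightarrow> (f n ^^ j) z \<in> D n"
  by (induction j) (auto simp: f_mem)

lemma F_funpow_mult:
  assumes "valid n" "z \<in> D n"
  shows "(F ^^ (j * 2 ^ n)) (d n * z) = d n * (f n ^^ j) z"
proof (induction j)
  case (Suc j)
  then show ?case using F_funpow_top[OF assms(1) f_funpow_mem[OF assms, of j]] by (simp add: funpow_add)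
qed simp

text \<open>While the orbit stays in the gap only the right branch acts, multiplying the distance to
  \<open>p n\<close> by \<open>b n\<close>; this cannot go on inside the unit interval.\<close>

lemma gap_escape:
  assumes "renormalizable n" "z \<noteq> p n"
  shows "\<exists>j. (f n ^^ j) z \<notin> gap n"
proof (rule ccontr)
  assume "\<nexists>j. (f n ^^ j) z \<notin> gap n"
  then have gap: "(f n ^^ j) z \<in> gap n" for j by blast
  have pos: "0 < w \<and> w < 1" if "w \<in> gap n" for w
    using that gap_bounds[OF assms(1)] by (auto simp: gap_def)
  have dist: "\<bar>(f n ^^ j) z - p n\<bar> = b n ^ j * \<bar>z - p n\<bar>" for j
  proof (induction j)
    case (Suc j)
    then show ?case using f_minus_p[of "(f n ^^ j) z" n] pos[OF gap[of j]] b_gt_1[of n]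
      by (simp add: abs_mult)
  qed simp
  obtain j where "1 / \<bar>z - p n\<bar> < b n ^ j" using real_arch_pow[OF b_gt_1] by blast
  then have "1 < \<bar>(f n ^^ j) z - p n\<bar>" using assms(2) by (simp add: dist field_simps)
  then show False using pos[OF gap[of j]] p_bounds[of n] by auto
qed

text \<open>Level by level: an orbit in \<open>K n\<close> is followed to the interval around 0, and
  there \<open>f n\<close> is iterated until the gap is left, unless the coordinate is
  \<open>p n\<close>.\<close>

lemma enters_K:
  assumes "valid n" "y \<in> {1 - \<beta>..1}"
  shows "\<exists>j. (F ^^ j) y \<in> K n \<or> (\<exists>m<n. (F ^^ j) y = d m * p m)"
  using assms(1)
proof (induction n)
  case 0
  then show ?case using assms(2) by (intro exI[of _ 0]) (simp add: K_0)
next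
  case (Suc n)
  then have v: "valid n" "renormalizable n" by (auto dest: valid_SucD)
  from Suc.IH[OF v(1)] obtain j where j: "(F ^^ j) y \<in> K n \<or> (\<exists>m<n. (F ^^ j) y = d m * p m)" by blast
  show ?case
  proof (cases "\<exists>m<n. (F ^^ j) y = d m * p m")
    case True
    then show ?thesis using less_SucI by blast
  next
    case False
    then obtain i z where i: "i \<in> {1..2 ^ n}" "z \<in> D n" "(F ^^ j) y = L n i z"
      using j by (auto simp: K_def)
    have top: "(F ^^ (2 ^ n - i + j)) y = d n * z"
      using F_funpow_L[OF v(1) i(2), of i "2 ^ n - i"] i
      unfolding funpow_add comp_apply by (simp add: L_top)
    show ?thesis
    proof (cases "z = p n")
      case True
      then show ?thesis using top by blast
    next
      case False
      obtain k where k: "(f n ^^ k) z \<notin> gap n" using gap_escape[OF v(2) False] by blast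
      define w where "w = (f n ^^ k) z"
      have "w \<in> D n" "w \<notin> gap n" using f_funpow_mem[OF v(1) i(2)] k by (auto simp: w_def)
      then have "w \<in> eL n ` D (Suc n) \<union> eR n ` D (Suc n)" using D_split[OF v(2)] by blast
      then have "L n (2 ^ n) w \<in> K (Suc n)" unfolding K_Suc by (intro UN_I[of "2 ^ n"]) auto
      moreover have "(F ^^ (k * 2 ^ n + (2 ^ n - i + j))) y = d n * w"
        using F_funpow_mult[OF v(1) i(2), of k] top by (simp add: funpow_add w_def)
      ultimately show ?thesis by (metis L_top)
    qed
  qed
qed

lemma countable_F_preimage: "countable {y. (F ^^ j) y = c}"
proof -
  have "finite {y. (F ^^ j) y = c}"
  proof (induction j)
    case (Suc j)
    have "{y. (F ^^ Suc j) y = c} \<subseteq> (\<Union>w\<in>{w. (F ^^ j) w = c}. {w - 1, (1 - w) / \<beta>})"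
    proof
      fix y assume "y \<in> {y. (F ^^ Suc j) y = c}"
      then have "F y \<in> {w. (F ^^ j) w = c}" by (simp add: funpow_swap1)
      moreover have "y \<in> {F y - 1, (1 - F y) / \<beta>}"
        using F_nonpos[of y] F_nonneg[of y] beta_gt_1 by (cases "y \<le> 0") auto
      ultimately show "y \<in> (\<Union>w\<in>{w. (F ^^ j) w = c}. {w - 1, (1 - w) / \<beta>})" by blast
    qed
    then show ?case by (rule finite_subset) (simp add: Suc.IH)
  qed simp
  then show ?thesis by (rule countable_finite)
qed

lemma countable_survivors:
  assumes "valid n"
  shows "countable {x \<in> {0<..1}. \<forall>k. (T ^^ k) x \<notin> K n}"
proof -
  have "{x \<in> {0<..1}. \<forall>k. (T ^^ k) x \<notin> K n} \<subseteq> (\<Union>j. \<Union>m<n. {y. (F ^^ j) y = d m * p m})"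
  proof
    fix x assume x: "x \<in> {x \<in> {0<..1}. \<forall>k. (T ^^ k) x \<notin> K n}"
    \<comment> \<open>The representative of an \<open>F\<close>-iterate in \<open>K n\<close> would
      be a \<open>T\<close>-iterate in \<open>K n\<close>.\<close>
    then have "(F ^^ j) x \<notin> K n" for j
      using unit_rep_K[OF assms, of "(F ^^ j) x"] unit_rep_F_funpow[of x j] by (auto simp: unit_rep_id)
    then show "x \<in> (\<Union>j. \<Union>m<n. {y. (F ^^ j) y = d m * p m})"
      using enters_K[OF assms, of x] x beta_gt_1 by auto
  qed
  then show ?thesis
    by (rule countable_subset) (intro countable_UN countable_F_preimage; simp)
qed

lemma T_funpow_K: "valid n \<Longrightarrow> x \<in> K n \<inter> {0<..1} \<Longrightarrow> (T ^^ k) x \<in> K n \<inter> {0<..1}"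
  using T_K neg_beta_map_range by (induction k) auto

text \<open>Forward invariance of \<open>K n\<close> makes the preimages decrease, and their
  intersection consists of the countably many points that never enter \<open>K n\<close>.\<close>

lemma gap_set_measure:
  assumes "valid n" "{0<..1} - gap_set \<beta> = K n \<inter> {0<..1}"
  shows "(\<lambda>k. measure lebesgue {x \<in> {0<..1}. (T ^^ k) x \<in> gap_set \<beta>}) \<longlonglongrightarrow> 0"
proof -
  define S where "S k = {x \<in> {0<..1}. (T ^^ k) x \<in> gap_set \<beta>}" for k
  have range: "(T ^^ k) x \<in> {0<..1}" if "x \<in> {0<..1}" for k x
    using that neg_beta_map_range by (cases k) auto
  have G: "(T ^^ k) x \<in> gap_set \<beta> \<longleftrightarrow> (T ^^ k) x \<notin> K n" if "x \<in> {0<..1}" for k x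
    using range[OF that] assms(2) by blast
  have "open (gap_set \<beta>)"
    unfolding gap_set_def gap_family_def gap_interval_def Let_def by (intro open_Union) auto
  moreover have T: "T \<in> borel_measurable borel"
    unfolding neg_beta_map_def by measurable
  ultimately have "(T ^^ k) -` gap_set \<beta> \<inter> space borel \<in> sets borel" for k
    by (intro measurable_sets[OF measurable_compose_n[OF T]]) auto
  moreover have "S k = {0<..1} \<inter> ((T ^^ k) -` gap_set \<beta> \<inter> space borel)" for k
    by (auto simp: S_def)
  ultimately have "S k \<in> sets borel" for k by simp
  then have meas: "S k \<in> sets lebesgue" for k by (simp add: sets_completionI_sets)
  have "decseq S"
  proof (rule decseq_SucI, rule subsetI)
    fix k x assume x: "x \<in> S (Suc k)"
    then have x': "x \<in> {0<..1}" "(T ^^ Suc k) x \<notin> K n" using G[of x "Suc k"] by (auto simp: S_def)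
    have "(T ^^ k) x \<notin> K n" using T_K[OF assms(1) _ range[OF x'(1), of k]] x'(2) by auto
    then show "x \<in> S k" using x' G by (auto simp: S_def)
  qed
  moreover have "emeasure lebesgue (S k) \<noteq> \<infinity>" for k
  proof -
    have "emeasure lebesgue (S k) \<le> emeasure lebesgue {0<..1::real}"
      by (intro emeasure_mono) (auto simp: S_def)
    also have "\<dots> < \<infinity>" by simp
    finally show ?thesis by simp
  qed
  ultimately have "(\<lambda>k. measure lebesgue (S k)) \<longlonglongrightarrow> measure lebesgue (\<Inter>k. S k)"
    using meas by (intro Lim_measure_decseq) auto
  moreover have "(\<Inter>k. S k) \<subseteq> {x \<in> {0<..1}. \<forall>k. (T ^^ k) x \<notin> K n}"
    using G by (auto simp: S_def)
  then have "(\<Inter>k. S k) \<in> null_sets lebesgue"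
    using countable_survivors[OF assms(1)]
    by (intro null_sets_completionI countable_imp_null_set_lborel) (rule countable_subset)
  then have "measure lebesgue (\<Inter>k. S k) = 0" by (rule measure_eq_0_null_sets)
  ultimately show ?thesis by (simp add: S_def)
qed

subsection \<open>Topological exactness\<close>

lemma b_mult_p: "(1 + b n) * p n = 1"
  using b_gt_1[of n] by (simp add: p_def)

text \<open>The open intervals eventually covered miss the two ends and \<open>p n\<close>; these
  are images of interior points other than \<open>p n\<close>. Without renormalizability,
  \<open>p n\<close> is the third image of 0 or has a preimage inside the left branch.\<close>

lemma reach_from_basis:
  assumes "valid n" "\<not> renormalizable n" "w \<in> D n"
  shows "\<exists>j\<le>3. \<exists>z. 1 - b n < z \<and> z < 1 \<and> z \<noteq> p n \<and> (f n ^^ j) z = w"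
proof -
  have b: "1 < b n" and a: "1 \<le> a n" using b_gt_1 a_ge_1 by auto
  note p = p_bounds[of n]
  have 0: "1 - b n < 0 \<and> (0::real) < 1 \<and> 0 \<noteq> p n" using b p by simp
  have orbit_0: "(f n ^^ 1) 0 = 1" "(f n ^^ 2) 0 = 1 - b n" "(f n ^^ 3) 0 = 1 + a n * (1 - b n)"
    using b by (simp_all add: numeral_2_eq_2 numeral_3_eq_3 f_pos f_neg)
  consider "w = 1" | "w = 1 - b n" | "w = p n" | "1 - b n < w" "w < 1" "w \<noteq> p n"
    using assms(3) by (force simp: D_def)
  then show ?thesis
  proof cases
    case 1
    then show ?thesis using 0 orbit_0(1) by (intro exI[of _ 1] conjI exI[of _ 0]) auto
  next
    case 2
    then show ?thesis using 0 orbit_0(2) by (intro exI[of _ 2] conjI exI[of _ 0]) auto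
  next
    case 3
    have le: "1 + a n * (1 - b n) \<le> p n"
      using assms(2) b unfolding renormalizable_def p_def
      by (simp add: field_simps power2_eq_square)
    show ?thesis
    proof (cases "1 + a n * (1 - b n) = p n")
      case True
      then show ?thesis using 0 orbit_0(3) 3 by (intro exI[of _ 3] conjI exI[of _ 0]) auto
    next
      case False
      define z where "z = (p n - 1) / a n"
      have "z < 0" using p a by (simp add: z_def divide_less_0_iff)
      moreover have "1 - b n < z" using le False a by (simp add: z_def field_simps)
      moreover have "f n z = w" using \<open>z < 0\<close> a 3 by (simp add: f_neg z_def)
      ultimately show ?thesis using p by (intro exI[of _ 1] conjI exI[of _ z]) auto
    qed
  next
    case 4
    then show ?thesis by (intro exI[of _ 0] conjI exI[of _ w]) auto
  qed
qed

lemma subinterval: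
  assumes "valid n" "x \<in> K n \<inter> {0<..1}" "0 < \<epsilon>"
  obtains i u v where "i \<in> {1..2 ^ n}" "1 - b n \<le> u" "u < v" "v \<le> 1"
    and "\<And>z. z \<in> {u<..<v} \<Longrightarrow> dist (L n i z) x < \<epsilon> \<and> 0 < L n i z"
proof -
  obtain i z where i: "i \<in> {1..2 ^ n}" "z \<in> D n" "x = L n i z" using assms(2) by (auto simp: K_def)
  obtain c e where "\<And>z. L n i z = c * z + e" using L_affine by blast
  then have "L n i = (\<lambda>z. c * z + e)" by auto
  then have cont: "isCont (L n i) z" by simp
  \<comment> \<open>The bound \<open>x\<close> keeps nearby points positive.\<close>
  have "0 < min \<epsilon> x" using assms by auto
  then obtain \<delta> where \<delta>: "0 < \<delta>" "\<And>w. dist w z < \<delta> \<Longrightarrow> dist (L n i w) x < min \<epsilon> x"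
    using cont i(3) unfolding continuous_at_eps_delta by (metis dist_commute)
  define u v where "u = max (1 - b n) (z - \<delta>)" and "v = min 1 (z + \<delta>)"
  have "1 - b n \<le> u" "u < v" "v \<le> 1"
    using i(2) \<delta>(1) b_gt_1[of n] by (auto simp: u_def v_def D_def)
  moreover have "dist (L n i w) x < \<epsilon> \<and> 0 < L n i w" if "w \<in> {u<..<v}" for w
  proof -
    have "dist w z < \<delta>" using that by (auto simp: u_def v_def dist_real_def)
    from \<delta>(2)[OF this] show ?thesis by (auto simp: dist_real_def)
  qed
  ultimately show ?thesis using that i(1) by blast
qed

lemma time_L:
  assumes "valid n" "z \<in> D n" "i \<in> {1..2 ^ n}"
  shows "itin n i + time (2 ^ n - i) (L n i z) = g_exp n"
proof -
  have "itin n i + time k (L n i z) = itin n (i + k)" if "i + k \<le> 2 ^ n" for k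
    using that
  proof (induction k)
    case (Suc k)
    then show ?case
      using F_funpow_L[OF assms(1,2), of i k] L_pos_iff[OF assms(1,2) one_mem_D, of "i + k"] assms(3)
        itin_Suc[of "i + k" n]
      by (auto simp: time_Suc)
  qed simp
  from this[of "2 ^ n - i"] show ?thesis using assms itin_top by simp
qed

lemma covers_all:
  assumes "valid n" "\<not> renormalizable n"
    and U: "openin (top_of_set (K n \<inter> {0<..1})) U" "U \<noteq> {}"
  shows "\<exists>k>0. (T ^^ k) ` U = K n \<inter> {0<..1}"
proof -
  define X where "X = K n \<inter> {0<..1}"
  define r l where "r = g_exp n + of_bool (even n)" and "l = g_exp n + of_bool (odd n)"
  obtain O' where O': "open O'" "U = X \<inter> O'" using U(1) unfolding openin_open X_def by blast
  obtain x where x: "x \<in> X" "x \<in> O'" using U(2) O'(2) by blast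
  then obtain \<epsilon> where \<epsilon>: "0 < \<epsilon>" "\<And>y. dist y x < \<epsilon> \<Longrightarrow> y \<in> O'"
    using O'(1) unfolding open_dist by blast
  obtain i u v where i: "i \<in> {1..2 ^ n}" and uv: "1 - b n \<le> u" "u < v" "v \<le> 1"
    and near: "\<And>z. z \<in> {u<..<v} \<Longrightarrow> dist (L n i z) x < \<epsilon> \<and> 0 < L n i z"
    using subinterval[OF assms(1) _ \<epsilon>(1), of x] x(1) unfolding X_def by metis
  define R where "R t x y \<longleftrightarrow>
    (\<forall>z\<in>{x<..<y} \<inter> D n. unit_rep (d n * z) \<in> (T ^^ t) ` U)" for t x y
  have F_step: "unit_rep (d n * f n z) \<in> (T ^^ (t + (g_exp n + of_bool (0 < d n * z)))) ` U"
    if "z \<in> D n" "unit_rep (d n * z) \<in> (T ^^ t) ` U" for z t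
  proof -
    have "d n * z \<le> 1" using L_le_1[OF assms(1) _ that(1), of "2 ^ n"] by (simp add: L_top)
    from unit_rep_F_funpow[OF this, of "2 ^ n"]
    have "unit_rep (d n * f n z) = (T ^^ (g_exp n + of_bool (0 < d n * z))) (unit_rep (d n * z))"
      by (simp only: F_funpow_top[OF assms(1) that(1)] time_top[OF assms(1) that(1)])
    then show ?thesis using that(2) by (auto simp: add.commute[of t] funpow_add)
  qed
  have R_right: "R (t + r) (1 - b n * y) (1 - b n * x)" if "R t x y" "0 \<le> x" "y \<le> 1" for t x y
    unfolding R_def
  proof
    fix w assume w: "w \<in> {1 - b n * y<..<1 - b n * x} \<inter> D n"
    define z where "z = (1 - w) / b n"
    have xy: "x < z" "z < y" using w b_gt_1[of n] by (auto simp: z_def field_simps)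
    then have z: "0 < z" using \<open>0 \<le> x\<close> by simp
    then have wz: "w = f n z" using b_gt_1[of n] by (simp add: z_def f_pos)
    have "z \<in> D n" using xy z \<open>y \<le> 1\<close> b_gt_1[of n] by (auto simp: D_def)
    moreover have "0 < d n * z \<longleftrightarrow> even n"
      using z by (simp add: zero_less_mult_iff d_pos_iff)
    ultimately show "unit_rep (d n * w) \<in> (T ^^ (t + r)) ` U"
      using F_step[of z t] that(1) xy wz by (simp add: R_def r_def)
  qed
  have R_left: "R (t + l) (1 + a n * x) (1 + a n * y)" if "R t x y" "1 - b n \<le> x" "y \<le> 0" for t x y
    unfolding R_def
  proof
    fix w assume w: "w \<in> {1 + a n * x<..<1 + a n * y} \<inter> D n"
    define z where "z = (w - 1) / a n"
    have a: "0 < a n" using a_ge_1[of n] by simp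
    have z: "x < z" "z < y" using w a by (auto simp: z_def field_simps)
    then have z': "z < 0" "w = f n z" using that(3) a by (auto simp: z_def f_neg)
    then have "z \<in> D n" using z that(2) by (auto simp: D_def)
    moreover have "0 < d n * z \<longleftrightarrow> odd n"
      using z'(1) d_pos_iff[of n] d_neq_0[of n] by (auto simp: zero_less_mult_iff)
    ultimately show "unit_rep (d n * w) \<in> (T ^^ (t + l)) ` U"
      using F_step[of z t] that(1) z z' by (simp add: R_def l_def)
  qed
  \<comment> \<open>The interval of index \<open>i\<close> still has to travel to the last one,
    which takes the remaining time of the round.\<close>
  have R_start: "R (g_exp n - itin n i) u v"
    unfolding R_def
  proof
    fix z assume z: "z \<in> {u<..<v} \<inter> D n"
    have pos: "0 < L n i z" "dist (L n i z) x < \<epsilon>" using near z by auto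
    have le: "L n i z \<le> 1" using L_le_1[OF assms(1) i] z by simp
    have "L n i z \<in> K n" using i z by (auto simp: K_def)
    then have "L n i z \<in> U" using pos le \<epsilon>(2) by (simp add: O'(2) X_def)
    moreover have "time (2 ^ n - i) (L n i z) = g_exp n - itin n i"
      using time_L[OF assms(1) _ i, of z] z by simp
    moreover have "(F ^^ (2 ^ n - i)) (L n i z) = d n * z"
      using F_funpow_L[OF assms(1), of z i "2 ^ n - i"] z i by (simp add: L_top)
    ultimately show "unit_rep (d n * z) \<in> (T ^^ (g_exp n - itin n i)) ` U"
      using unit_rep_F_funpow[OF le, of "2 ^ n - i"] unit_rep_id[of "L n i z"] pos le by auto
  qed
  have R_sub: "R t x' y'" if "R t x y" "x \<le> x'" "y' \<le> y" for t x y x' y'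
    using that by (auto simp: R_def)
  have "a n + b n \<le> a n * b n ^ 2" using assms(2) by (simp add: renormalizable_def)
  from a_ge_1 b_gt_1 ab_le[OF assms(1)] this have "\<exists>t. R t (1 / (1 + b n)) 1"
    by (rule skew_tent_growth[where R = R and r = r and l = l, OF _ _ _ _ _ _ _ R_start uv])
      (blast intro: R_sub R_right R_left)+
  then obtain t\<^sub>0 where t0: "R t\<^sub>0 (p n) 1" unfolding p_def by blast
  have bp: "1 - b n * p n = p n" using b_mult_p[of n] by (simp add: algebra_simps)
  note p = p_bounds[of n]
  \<comment> \<open>The right branch exchanges the sides of \<open>p n\<close>, using only
    \<open>{0..p n}\<close> of the left side. The rest \<open>{1 - b n..0}\<close> also covers the
    right side, through the left branch, as level \<open>n\<close> is not renormalizable.\<close>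
  have PQ: "R (t + r) (1 - b n) (p n)" if "R t (p n) 1" for t
    using R_right[OF that] p bp by simp
  have QP: "R (t + r) (p n) 1" if "R t (1 - b n) (p n)" for t
    using R_right[OF R_sub[OF that, of 0 "p n"]] p bp b_gt_1[of n] by simp
  have QP': "R (t + l) (p n) 1" if "R t (1 - b n) (p n)" for t
  proof -
    have "R (t + l) (1 + a n * (1 - b n)) 1"
      using R_left[OF R_sub[OF that, of "1 - b n" 0]] p by simp
    moreover have "1 + a n * (1 - b n) \<le> p n"
      using assms(2) b_gt_1[of n] unfolding renormalizable_def p_def
      by (simp add: field_simps power2_eq_square)
    ultimately show ?thesis using R_sub by blast
  qed
  have "0 < r" using g_exp_ge[of n] by (cases "n = 0") (auto simp: r_def)
  moreover have "l = Suc r \<or> r = Suc l" by (auto simp: r_def l_def)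
  ultimately obtain N where N: "\<And>t. N \<le> t \<Longrightarrow> R t (p n) 1 \<and> R t (1 - b n) (p n)"
    using eventually_all_times[of "\<lambda>t. R t (p n) 1" "\<lambda>t. R t (1 - b n) (p n)", OF PQ QP QP' _ _ t0]
    by blast
  \<comment> \<open>A point of \<open>K n\<close> is at most three full rounds and one partial round
    away from a covered point, and each \<open>F\<close>-step takes \<open>T\<close>-time at most
    1.\<close>
  define M where "M = Suc (N + 4 * 2 ^ n)"
  have "(T ^^ M) ` U \<subseteq> X" using T_funpow_K[OF assms(1)] O'(2) by (auto simp: X_def)
  moreover have "X \<subseteq> (T ^^ M) ` U"
  proof
    fix y assume y: "y \<in> X"
    then obtain j w where j: "j \<in> {1..2 ^ n}" "w \<in> D n" "y = L n j w" by (auto simp: X_def K_def)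
    \<comment> \<open>The partial round of \<open>j\<close> steps applies \<open>f n\<close> to the
      chart coordinate once, so the target is a preimage of \<open>w\<close>.\<close>
    obtain w' where w': "w' \<in> D n" "f n w' = w" using f_surj[OF j(2)] by blast
    obtain k z where k: "k \<le> 3" and z: "1 - b n < z" "z < 1" "z \<noteq> p n" "(f n ^^ k) z = w'"
      using reach_from_basis[OF assms(1,2) w'(1)] by blast
    have zD: "z \<in> D n" using z by (simp add: D_def)
    define s where "s = time (j + k * 2 ^ n) (d n * z)"
    have "(F ^^ (j + k * 2 ^ n)) (d n * z) = y"
      unfolding funpow_add comp_apply F_funpow_mult[OF assms(1) zD] z(4)
      using F_funpow_eq_L[OF assms(1) w'(1) j(1)] w'(2) j(3) by simp
    moreover have "d n * z \<le> 1" using L_le_1[OF assms(1) _ zD, of "2 ^ n"] by (simp add: L_top)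
    moreover have "unit_rep y = y" using y by (intro unit_rep_id) (simp add: X_def)
    ultimately have ys: "y = (T ^^ s) (unit_rep (d n * z))"
      using unit_rep_F_funpow[of "d n * z" "j + k * 2 ^ n"] by (simp add: s_def)
    have "k * 2 ^ n \<le> 3 * 2 ^ n" using k by (rule mult_right_mono) simp
    then have "s \<le> 4 * 2 ^ n"
      using time_le[of "j + k * 2 ^ n" "d n * z"] j(1)
      unfolding s_def atLeastAtMost_iff by linarith
    then have s: "N \<le> M - s" "M = s + (M - s)" by (auto simp: M_def)
    have "unit_rep (d n * z) \<in> (T ^^ (M - s)) ` U"
      using N[OF s(1)] z zD by (cases "z < p n") (auto simp: R_def)
    then show "y \<in> (T ^^ M) ` U"
      unfolding ys by (subst s(2)) (auto simp: funpow_add)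
  qed
  ultimately show ?thesis unfolding X_def[symmetric] by (intro exI[of _ M]) (simp add: M_def)
qed

end

theorem theorem2p2:
  fixes \<beta> :: real
  assumes "\<beta> > 1"
  shows "locally_eventually_onto ({0<..1} - gap_set \<beta>) (neg_beta_map \<beta>)
    \<and> {x \<in> {0<..1}. neg_beta_map \<beta> x \<in> gap_set \<beta>} \<subseteq> gap_set \<beta>
    \<and> (\<lambda>k. measure lebesgue {x \<in> {0<..1}. (neg_beta_map \<beta> ^^ k) x \<in> gap_set \<beta>}) \<longlonglongrightarrow> 0"
proof -
  interpret negative_beta \<beta> using assms by unfold_locales
  obtain n where n: "gap_set \<beta> = \<Union> (gap_family n \<beta>)"
    "\<forall>m<n. \<beta> ^ (g_exp (Suc m) + 1) < \<beta> + 1" "\<beta> + 1 \<le> \<beta> ^ (g_exp (Suc n) + 1)"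
    using gap_level[OF assms] by blast
  have valid: "valid n" "\<not> renormalizable n"
    using n unfolding valid_def renormalizable_iff by auto
  have X: "{0<..1} - gap_set \<beta> = K n \<inter> {0<..1}"
    using K_partition[OF valid(1)] assms unfolding n(1) Union_gap_family[OF valid(1)] by auto
  have T: "T x \<in> K n \<inter> {0<..1}" if "x \<in> K n \<inter> {0<..1}" for x
    using T_funpow_K[OF valid(1) that, of 1] by simp
  have "locally_eventually_onto ({0<..1} - gap_set \<beta>) T"
    unfolding locally_eventually_onto_def X using T covers_all[OF valid] by blast
  \<comment> \<open>Backward invariance of the gap set is forward invariance of its
    complement.\<close>
  moreover have "x \<in> gap_set \<beta>" if "x \<in> {0<..1}" "T x \<in> gap_set \<beta>" for x
    using that T[of x] X by blast
  ultimately show ?thesis using gap_set_measure[OF valid(1) X] by blast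
qed

end
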